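(* For every problem $f$: (1) $f\leq_{\mathrm{sW}}\Sigma\Pi f\iff\Pi f\equiv_{\mathrm{sW}}\Sigma\Pi f$; (2) $\Sigma\Pi f\leq_{\mathrm{sW}}f\iff\Sigma f\equiv_{\mathrm{sW}}\Sigma\Pi f$; (3) $f\leq_{\mathrm{sW}}\Pi\Sigma f\iff\Pi f\equiv_{\mathrm{sW}}\Pi\Sigma f$; (4) $\Pi\Sigma f\leq_{\mathrm{sW}}f\iff\Sigma f\equiv_{\mathrm{sW}}\Pi\Sigma f$. Analogous statements hold with $\leq_{\mathrm{sW}}$ (and its induced equivalence $\equiv_{\mathrm{sW}}$) replaced throughout by any of $\leq_{\mathrm W}$, $\leq_{\mathrm{sW}}^*$, $\leq_{\mathrm W}^*$ (and the respective induced equivalence).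
   Context: A represented space is a set $X$ with a partial surjective map $\delta_X:\subseteq\mathbb N^{\mathbb N}\to X$. A problem is a partial multi-valued function $f:\subseteq X\rightrightarrows Y$ between represented spaces that has a realizer; a realizer of $f$ is a function $F:\subseteq\mathbb N^{\mathbb N}\to\mathbb N^{\mathbb N}$ with $\delta_YF(p)\in f\delta_X(p)$ for all $p\in\mathrm{dom}(f\delta_X)$. For $p,q\in\mathbb N^{\mathbb N}$, $\langle p,q\rangle(2n)=p(n)$, $\langle p,q\rangle(2n+1)=q(n)$. For problems $f,g$: $f\leq_{\mathrm W}g$ if there are computable $H,K:\subseteq\mathbb N^{\mathbb N}\to\mathbb N^{\mathbb N}$ such that $H\langle\mathrm{id},GK\rangle$ is a realizer of $f$ whenever $G$ is a realizer of $g$; $f\leq_{\mathrm{sW}}g$ is defined likewise with $HGK$ instead of $H\langle\mathrm{id},GK\rangle$. $\leq_{\mathrm W}^*$ and $\leq_{\mathrm{sW}}^*$ are defined likewise with continuous instead of computable $H,K$. The equivalence induced by a reducibility $\leq$ is reducibility in both directions. For a represented space $Y$, the completion $\overline Y:=Y\cup\{\bot\}$ ($\bot\notin Y$) is represented by the total map $\delta_{\overline Y}$ with $\delta_{\overline Y}(p)=\delta_Y(p-1)$ if $p-1\in\mathrm{dom}(\delta_Y)$ and $\delta_{\overline Y}(p)=\bot$ otherwise, where $p-1\in\mathbb N^{\mathbb N}\cup\mathbb N^*$ is the concatenation of $p(0)-1,p(1)-1,\dots$ and $0-1$ is the empty word. $X^{\mathbb N}$ is represented by $\langle p_0,p_1,\dots\rangle\mapsto(\delta_X(p_n))_n$,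 where $\langle p_0,p_1,\dots\rangle\langle n,k\rangle:=p_n(k)$ and $\langle n,k\rangle:=\frac12(n+k)(n+k+1)+k$ for $n,k\in\mathbb N$. For $f:\subseteq X\rightrightarrows Y$: the parallelization $\Pi f:\subseteq X^{\mathbb N}\rightrightarrows Y^{\mathbb N}$ has domain $\mathrm{dom}(f)^{\mathbb N}$ and $\Pi f((x_n)_n)=\{(y_n)_n:(\forall n)\ y_n\in f(x_n)\}$; the stashing $\Sigma f:\subseteq X^{\mathbb N}\rightrightarrows\overline Y^{\mathbb N}$ has domain $\mathrm{dom}(f)^{\mathbb N}$ and $\Sigma f((x_n)_n)=\{(y_n)_n\in\overline Y^{\mathbb N}:(\exists n)\ y_n\in f(x_n)\}$. Words such as $\Pi\Sigma f$ denote iterated application, $\Pi\Sigma f=\Pi(\Sigma f)$. *)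

theory Defs
  imports "HOL-Analysis.Function_Topology" "HOL-Library.Nat_Bijection"
begin

section \<open>Computable and continuous partial functions on Baire space\<close>

type_synonym baire = "nat \<Rightarrow> nat"

text \<open>
  Programs for Kleene's mu-recursive functions with an oracle; \<open>Query\<close> asks the oracle
  for one of its values. In \<open>computes p e xs y\<close> the oracle is \<open>p\<close>, the arguments are \<open>xs\<close>.
\<close>

datatype prog = Zero | Succ | Query | Proj nat | Comp prog "prog list" | PrimRec prog prog | Mu prog

inductive computes :: "baire \<Rightarrow> prog \<Rightarrow> nat list \<Rightarrow> nat \<Rightarrow> bool" for p :: baire where
  Zero: "computes p Zero xs 0"
| Succ: "computes p Succ [x] (Suc x)"
| Query: "computes p Query [x] (p x)"
| Proj: "i < length xs \<Longrightarrow> computes p (Proj i) xs (xs ! i)"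
| Comp: "list_all2 (\<lambda>g y. computes p g xs y) gs ys \<Longrightarrow> computes p f ys z
    \<Longrightarrow> computes p (Comp f gs) xs z"
| PrimRec_0: "computes p f xs z \<Longrightarrow> computes p (PrimRec f g) (0 # xs) z"
| PrimRec_Suc: "computes p (PrimRec f g) (n # xs) y \<Longrightarrow> computes p g (n # y # xs) z
    \<Longrightarrow> computes p (PrimRec f g) (Suc n # xs) z"
| Mu: "computes p f (n # xs) 0 \<Longrightarrow> \<forall>m<n. \<exists>y. computes p f (m # xs) (Suc y)
    \<Longrightarrow> computes p (Mu f) xs n"

text \<open>
  As usual for Type-2 computability, the computation is only constrained on the domain of the
  function, so restrictions of computable partial functions are computable. The same holds for
  continuity, which refers to the subspace topology on the domain; the topology on
  \<^typ>\<open>nat \<Rightarrow> nat\<close> is the product of the discrete topologies.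
\<close>

definition computable_fun :: "(baire \<rightharpoonup> baire) \<Rightarrow> bool" where
  "computable_fun F \<longleftrightarrow> (\<exists>e. \<forall>p q. F p = Some q \<longrightarrow> (\<forall>n. computes p e [n] (q n)))"

definition continuous_fun :: "(baire \<rightharpoonup> baire) \<Rightarrow> bool" where
  "continuous_fun F \<longleftrightarrow> continuous_on (dom F) (\<lambda>p. the (F p))"

lemma computes_deterministic: "computes p e xs y \<Longrightarrow> computes p e xs z \<Longrightarrow> y = z"
proof (induction e xs y arbitrary: z rule: computes.induct)
  case (Comp xs gs ys f z')
  from Comp.prems obtain ys' where ys': "list_all2 (\<lambda>g y. computes p g xs y) gs ys'"
    "computes p f ys' z" by (cases rule: computes.cases) auto
  have "ys = ys'"
    using Comp.IH(1) ys'(1) by (auto simp: list_all2_conv_all_nth intro!: nth_equalityI)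
  with Comp.IH(2) ys'(2) show ?case by blast
next
  case (Mu f n xs)
  from Mu.prems have z: "computes p f (z # xs) 0" "\<forall>m<z. \<exists>y. computes p f (m # xs) (Suc y)"
    by (cases rule: computes.cases; auto)+
  show ?case
  proof (rule linorder_cases[of n z])
    assume "n < z"
    with z(2) Mu.IH(1) show ?thesis by blast
  next
    assume "z < n"
    with z(1) Mu.IH(2) show ?thesis by fastforce
  qed
next
  case (PrimRec_Suc f g n xs y z')
  from PrimRec_Suc.prems show ?case
    by (cases rule: computes.cases) (use PrimRec_Suc.IH in blast)
next
  case (PrimRec_0 f xs z' g)
  from PrimRec_0.prems show ?case
    by (cases rule: computes.cases) (use PrimRec_0.IH in blast)
qed (auto elim: computes.cases)

section \<open>Pairing functions\<close>

definition baire_pair :: "baire \<Rightarrow> baire \<Rightarrow> baire" where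
  "baire_pair p q = (\<lambda>n. if even n then p (n div 2) else q (n div 2))"

definition cantor_pair :: "nat \<Rightarrow> nat \<Rightarrow> nat" where
  "cantor_pair n k = (n + k) * (n + k + 1) div 2 + k"

lemma cantor_pair_eq_prod_encode: "cantor_pair n k = prod_encode (k, n)"
  by (simp add: cantor_pair_def prod_encode_def triangle_def add.commute)

text \<open>
  As \<^const>\<open>cantor_pair\<close> is a bijection, every point of Baire space is of the form
  \<open>\<langle>p\<^sub>0, p\<^sub>1, \<dots>\<rangle>\<close> for exactly one sequence; \<open>component q n\<close> is its member \<open>p\<^sub>n\<close>.
\<close>

definition component :: "baire \<Rightarrow> nat \<Rightarrow> baire" where
  "component q n = (\<lambda>k. q (cantor_pair n k))"

lemma ex1_baire_tuple: "\<exists>!q. \<forall>n k. q (cantor_pair n k) = p n k"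
proof
  show "\<forall>n k. (\<lambda>m. case prod_decode m of (k, n) \<Rightarrow> p n k) (cantor_pair n k) = p n k"
    by (simp add: cantor_pair_eq_prod_encode)
next
  fix q assume q: "\<forall>n k. q (cantor_pair n k) = p n k"
  show "q = (\<lambda>m. case prod_decode m of (k, n) \<Rightarrow> p n k)"
  proof
    fix m
    obtain k n where "prod_decode m = (k, n)" by force
    then show "q m = (case prod_decode m of (k, n) \<Rightarrow> p n k)"
      using q by (metis cantor_pair_eq_prod_encode prod.simps(2) prod_decode_inverse)
  qed
qed

section \<open>Represented spaces\<close>

text \<open>
  A represented space is given by its representation \<open>\<delta>\<close> alone; being surjective,
  \<open>\<delta>\<close> determines the underlying set as \<open>ran \<delta>\<close>.
\<close>

type_synonym 'a representation = "baire \<rightharpoonup> 'a"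

definition seq_rep :: "'a representation \<Rightarrow> (nat \<Rightarrow> 'a) representation" where
  "seq_rep \<delta> q = (if \<forall>n. component q n \<in> dom \<delta> then Some (\<lambda>n. the (\<delta> (component q n))) else None)"

text \<open>
  \<open>minus_one p\<close> is the concatenation \<open>p - 1\<close> if that is an infinite sequence, and \<^const>\<open>None\<close> if it
  is a finite word (finite words lie in the domain of no representation).
\<close>

definition minus_one :: "baire \<rightharpoonup> baire" where
  "minus_one p =
    (if infinite {n. p n \<noteq> 0} then Some (\<lambda>k. p (enumerate {n. p n \<noteq> 0} k) - 1) else None)"

text \<open>In the completion of a space, \<^const>\<open>None\<close> is the new point \<open>\<bottom>\<close>; the representation is total.\<close>

definition completion_rep :: "'a representation \<Rightarrow> 'a option representation" where
  "completion_rep \<delta> p = Some ((\<delta> \<circ>\<^sub>m minus_one) p)"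

section \<open>Problems\<close>

text \<open>
  A partial multi-valued function is given by \<open>sol\<close>, its domain consisting of the points with a
  nonempty set of values.
\<close>

record ('a, 'b) problem =
  in_rep :: "'a representation"
  out_rep :: "'b representation"
  sol :: "'a \<Rightarrow> 'b set"

definition pdom :: "('a, 'b) problem \<Rightarrow> 'a set" where
  "pdom f = {x. sol f x \<noteq> {}}"

definition realizer :: "('a, 'b) problem \<Rightarrow> (baire \<rightharpoonup> baire) \<Rightarrow> bool" where
  "realizer f F \<longleftrightarrow> (\<forall>p x. in_rep f p = Some x \<and> x \<in> pdom f \<longrightarrow>
     (\<exists>y. (out_rep f \<circ>\<^sub>m F) p = Some y \<and> y \<in> sol f x))"

definition is_problem :: "('a, 'b) problem \<Rightarrow> bool" where
  "is_problem f \<longleftrightarrow> pdom f \<subseteq> ran (in_rep f) \<and> (\<forall>x. sol f x \<subseteq> ran (out_rep f)) \<and> (\<exists>F. realizer f F)"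

definition parallelization :: "('a, 'b) problem \<Rightarrow> (nat \<Rightarrow> 'a, nat \<Rightarrow> 'b) problem" (\<open>\<Pi>\<close>) where
  "parallelization f =
    \<lparr>in_rep = seq_rep (in_rep f),
     out_rep = seq_rep (out_rep f),
     sol = (\<lambda>x. if \<forall>n. x n \<in> pdom f then {y. \<forall>n. y n \<in> sol f (x n)} else {})\<rparr>"

definition stashing :: "('a, 'b) problem \<Rightarrow> (nat \<Rightarrow> 'a, nat \<Rightarrow> 'b option) problem" (\<open>\<Sigma>\<close>) where
  "stashing f =
    \<lparr>in_rep = seq_rep (in_rep f),
     out_rep = seq_rep (completion_rep (out_rep f)),
     sol = (\<lambda>x. if \<forall>n. x n \<in> pdom f
       then {y. (\<forall>n. y n \<in> ran (completion_rep (out_rep f))) \<and> (\<exists>n. y n \<in> Some ` sol f (x n))}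
       else {})\<rparr>"

section \<open>Weihrauch reducibilities\<close>

text \<open>
  The class \<open>\<C>\<close> of admissible \<open>H\<close> and \<open>K\<close> is \<^const>\<open>computable_fun\<close> or \<^const>\<open>continuous_fun\<close>.
\<close>

definition strong_reducible ::
    "((baire \<rightharpoonup> baire) \<Rightarrow> bool) \<Rightarrow> ('a, 'b) problem \<Rightarrow> ('c, 'd) problem \<Rightarrow> bool" where
  "strong_reducible \<C> f g \<longleftrightarrow> (\<exists>H K. \<C> H \<and> \<C> K \<and>
     (\<forall>G. realizer g G \<longrightarrow> realizer f (H \<circ>\<^sub>m (G \<circ>\<^sub>m K))))"

definition reducible ::
    "((baire \<rightharpoonup> baire) \<Rightarrow> bool) \<Rightarrow> ('a, 'b) problem \<Rightarrow> ('c, 'd) problem \<Rightarrow> bool" where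
  "reducible \<C> f g \<longleftrightarrow> (\<exists>H K. \<C> H \<and> \<C> K \<and>
     (\<forall>G. realizer g G \<longrightarrow> realizer f (H \<circ>\<^sub>m (\<lambda>p. map_option (baire_pair p) ((G \<circ>\<^sub>m K) p)))))"

abbreviation le_sW (infix \<open>\<le>\<^sub>s\<^sub>W\<close> 50) where "f \<le>\<^sub>s\<^sub>W g \<equiv> strong_reducible computable_fun f g"
abbreviation le_W (infix \<open>\<le>\<^sub>W\<close> 50) where "f \<le>\<^sub>W g \<equiv> reducible computable_fun f g"
abbreviation le_sW_star (infix \<open>\<le>\<^sub>s\<^sub>W\<^sup>*\<close> 50) where "f \<le>\<^sub>s\<^sub>W\<^sup>* g \<equiv> strong_reducible continuous_fun f g"
abbreviation le_W_star (infix \<open>\<le>\<^sub>W\<^sup>*\<close> 50) where "f \<le>\<^sub>W\<^sup>* g \<equiv> reducible continuous_fun f g"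

abbreviation equiv_sW (infix \<open>\<equiv>\<^sub>s\<^sub>W\<close> 50) where "f \<equiv>\<^sub>s\<^sub>W g \<equiv> f \<le>\<^sub>s\<^sub>W g \<and> g \<le>\<^sub>s\<^sub>W f"
abbreviation equiv_W (infix \<open>\<equiv>\<^sub>W\<close> 50) where "f \<equiv>\<^sub>W g \<equiv> f \<le>\<^sub>W g \<and> g \<le>\<^sub>W f"
abbreviation equiv_sW_star (infix \<open>\<equiv>\<^sub>s\<^sub>W\<^sup>*\<close> 50) where "f \<equiv>\<^sub>s\<^sub>W\<^sup>* g \<equiv> f \<le>\<^sub>s\<^sub>W\<^sup>* g \<and> g \<le>\<^sub>s\<^sub>W\<^sup>* f"
abbreviation equiv_W_star (infix \<open>\<equiv>\<^sub>W\<^sup>*\<close> 50) where "f \<equiv>\<^sub>W\<^sup>* g \<equiv> f \<le>\<^sub>W\<^sup>* g \<and> g \<le>\<^sub>W\<^sup>* f"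

end

theory Submission
  imports Defs
begin

text \<open>
  Parallelization is a closure operator and stashing an interior operator for each of the four
  reducibilities. Given this, all equivalences reduce to
  \<open>\<Pi>\<Sigma>\<Pi> f \<le>\<^sub>s\<^sub>W \<Sigma>\<Pi> f\<close> and \<open>\<Pi>\<Sigma> f \<le>\<^sub>s\<^sub>W \<Sigma>\<Pi>\<Sigma> f\<close>, which only rearrange instances.

  The analytic point is that the answers to a stashing are names in a completion, where a
  computation on the underlying name may diverge. A partial function \<open>F\<close> therefore has to be
  replaced by a total one whose values \<open>r\<close> satisfy \<open>r - 1 = F p\<close> wherever \<open>F p\<close> is defined: in
  stage \<open>s\<close> it emits the next value of \<open>F p\<close>, increased by one, if this is found in \<open>s\<close> steps
  (or, for continuous \<open>F\<close>, is determined by the first \<open>s\<close> values of \<open>p\<close>), and \<open>0\<close> otherwise.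
\<close>

section \<open>Programs with parameters\<close>

text \<open>An answer to a stash is correct at some unknown position, and only with respect to the
  instance standing at that same position. This shapes both rearrangements. In \<Pi>\<Sigma>\<Pi> f
  the correct positions of different sequences may differ, whereas one stash guarantees a single
  position; merging all sequences position by position into parallel instances lets one correct
  position serve all of them. For \<Sigma>\<Pi>\<Sigma> f it would not help to put a copy of the
  given instance at every outer position: the answers from different copies would compete for the
  same place in the output, and nothing tells which copy was answered correctly. Disjoint
  subsequences give each combination of an outer and an inner position a place of its own. The class
  of admissible functions enters only through a few closure properties, and the difference between
  strong and ordinary reductions only through what the outer function gets to see, so one argument
  covers all four reducibilities.\<close>

definition comp_on :: "baire set \<Rightarrow> nat \<Rightarrow> (baire \<Rightarrow> nat list \<Rightarrow> nat) \<Rightarrow> bool" where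
  "comp_on D k \<phi> \<longleftrightarrow> (\<exists>e. \<forall>p\<in>D. \<forall>xs. length xs = k \<longrightarrow> computes p e xs (\<phi> p xs))"

lemma comp_on_cong:
  assumes "comp_on D k \<phi>" "\<And>p xs. p \<in> D \<Longrightarrow> length xs = k \<Longrightarrow> \<psi> p xs = \<phi> p xs"
  shows "comp_on D k \<psi>"
  using assms unfolding comp_on_def by simp

lemma comp_on_compose:
  assumes "comp_on D (length fs) g" and "\<And>f. f \<in> set fs \<Longrightarrow> comp_on D k f"
  shows "comp_on D k (\<lambda>p xs. g p (map (\<lambda>f. f p xs) fs))"
proof -
  obtain e where e: "\<forall>p\<in>D. \<forall>xs. length xs = length fs \<longrightarrow> computes p e xs (g p xs)"
    using assms(1) unfolding comp_on_def by blast
  obtain d where d: "\<forall>f\<in>set fs. \<forall>p\<in>D. \<forall>xs. length xs = k \<longrightarrow> computes p (d f) xs (f p xs)"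
    using assms(2) unfolding comp_on_def by metis
  have "computes p (Comp e (map d fs)) xs (g p (map (\<lambda>f. f p xs) fs))"
    if "p \<in> D" "length xs = k" for p xs
    using that d by (intro computes.Comp[OF _ e[rule_format]])
      (auto simp: list_all2_conv_all_nth)
  then show ?thesis unfolding comp_on_def by blast
qed

lemma comp_on_compose1:
  assumes "comp_on D 1 g" "comp_on D k a"
  shows "comp_on D k (\<lambda>p xs. g p [a p xs])"
  using comp_on_compose[of D "[a]" g k] assms by simp

lemma comp_on_compose2:
  assumes "comp_on D 2 g" "comp_on D k a" "comp_on D k b"
  shows "comp_on D k (\<lambda>p xs. g p [a p xs, b p xs])"
  using comp_on_compose[of D "[a, b]" g k] assms by (auto simp: numeral_2_eq_2)

lemma comp_on_nth: "i < k \<Longrightarrow> comp_on D k (\<lambda>p xs. xs ! i)"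
  unfolding comp_on_def using computes.Proj by blast

lemma comp_on_hd: "0 < k \<Longrightarrow> comp_on D k (\<lambda>p xs. hd xs)"
  by (rule comp_on_cong[OF comp_on_nth[of 0]]) (auto simp: hd_conv_nth)

lemma comp_on_last: "0 < k \<Longrightarrow> comp_on D k (\<lambda>p xs. last xs)"
  by (rule comp_on_cong[OF comp_on_nth[of "k - 1"]]) (auto simp: last_conv_nth)

lemma comp_on_Suc:
  assumes "comp_on D k f" shows "comp_on D k (\<lambda>p xs. Suc (f p xs))"
proof -
  have "comp_on D 1 (\<lambda>p xs. Suc (xs ! 0))"
    unfolding comp_on_def by (auto simp: length_Suc_conv intro!: exI[of _ Succ] computes.Succ)
  from comp_on_compose1[OF this assms] show ?thesis by simp
qed

lemma comp_on_query:
  assumes "comp_on D k f" shows "comp_on D k (\<lambda>p xs. p (f p xs))"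
proof -
  have "comp_on D 1 (\<lambda>p xs. p (xs ! 0))"
    unfolding comp_on_def by (auto simp: length_Suc_conv intro!: exI[of _ Query] computes.Query)
  from comp_on_compose1[OF this assms] show ?thesis by simp
qed

lemma comp_on_const: "comp_on D k (\<lambda>p xs. c)"
proof (induction c)
  case 0
  show ?case unfolding comp_on_def using computes.Zero by blast
qed (rule comp_on_Suc)

lemma comp_on_rec:
  assumes f: "comp_on D k f" and g: "comp_on D (Suc (Suc k)) g" and a: "comp_on D k a"
  shows "comp_on D k (\<lambda>p xs. rec_nat (f p xs) (\<lambda>n y. g p (n # y # xs)) (a p xs))"
proof -
  let ?R = "\<lambda>p xs. rec_nat (f p xs) (\<lambda>n y. g p (n # y # xs))"
  obtain e where e: "\<forall>p\<in>D. \<forall>xs. length xs = k \<longrightarrow> computes p e xs (f p xs)"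
    using f unfolding comp_on_def by blast
  obtain d where d: "\<forall>p\<in>D. \<forall>xs. length xs = Suc (Suc k) \<longrightarrow> computes p d xs (g p xs)"
    using g unfolding comp_on_def by blast
  have "computes p (PrimRec e d) (n # xs) (?R p xs n)" if "p \<in> D" "length xs = k" for p xs n
    using that by (induction n) (auto intro!: computes.PrimRec_0 computes.PrimRec_Suc e[rule_format] d[rule_format])
  then have "comp_on D (Suc k) (\<lambda>p xs. ?R p (tl xs) (hd xs))"
    unfolding comp_on_def by (auto simp: length_Suc_conv intro!: exI[of _ "PrimRec e d"])
  then have "comp_on D (length (a # map (\<lambda>i p xs. xs ! i) [0..<k])) (\<lambda>p xs. ?R p (tl xs) (hd xs))"
    by simp
  from comp_on_compose[OF this]
  have "comp_on D k (\<lambda>p xs. ?R p (map ((!) xs) [0..<k]) (a p xs))"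
    using a by (force simp: comp_on_nth o_def)
  then show ?thesis
    by (rule comp_on_cong) (auto simp: map_nth)
qed

text \<open>Termination of the search is demanded for oracles in \<open>D\<close> only. This is why
  \<open>comp_on\<close> carries a set of oracles: removing the zeros from a name, for instance,
  succeeds only if infinitely many entries are nonzero.\<close>

lemma comp_on_Least:
  assumes f: "comp_on D (Suc k) f"
    and ex: "\<And>p xs. p \<in> D \<Longrightarrow> length xs = k \<Longrightarrow> \<exists>m. f p (m # xs) = 0"
  shows "comp_on D k (\<lambda>p xs. LEAST m. f p (m # xs) = 0)"
proof -
  obtain e where e: "\<forall>p\<in>D. \<forall>xs. length xs = Suc k \<longrightarrow> computes p e xs (f p xs)"
    using f unfolding comp_on_def by blast
  have "computes p (Mu e) xs (LEAST m. f p (m # xs) = 0)" if "p \<in> D" "length xs = k" for p xs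
  proof (rule computes.Mu)
    have "f p ((LEAST m. f p (m # xs) = 0) # xs) = 0"
      using ex[OF that] by (rule LeastI_ex)
    then show "computes p e ((LEAST m. f p (m # xs) = 0) # xs) 0"
      using e[rule_format, of p "(LEAST m. f p (m # xs) = 0) # xs"] that by simp
    show "\<forall>n<LEAST m. f p (m # xs) = 0. \<exists>y. computes p e (n # xs) (Suc y)"
    proof (intro allI impI)
      fix n assume "n < (LEAST m. f p (m # xs) = 0)"
      then have "f p (n # xs) \<noteq> 0" by (rule not_less_Least)
      then obtain y where "f p (n # xs) = Suc y" by (cases "f p (n # xs)") auto
      then show "\<exists>y. computes p e (n # xs) (Suc y)"
        using e[rule_format, of p "n # xs"] that by auto
    qed
  qed
  then show ?thesis unfolding comp_on_def by blast
qed

lemma comp_on_pred: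
  assumes "comp_on D k f" shows "comp_on D k (\<lambda>p xs. f p xs - 1)"
proof -
  have "comp_on D k (\<lambda>p xs. rec_nat 0 (\<lambda>n y. (\<lambda>p zs. zs ! 0) p (n # y # xs)) (f p xs))"
    by (rule comp_on_rec[where g = "\<lambda>p zs. zs ! 0"]) (auto intro: assms comp_on_const comp_on_nth)
  moreover have "rec_nat 0 (\<lambda>n y. n) m = m - 1" for m :: nat by (cases m) auto
  ultimately show ?thesis by simp
qed

lemma comp_on_add:
  assumes "comp_on D k f" "comp_on D k g" shows "comp_on D k (\<lambda>p xs. f p xs + g p xs)"
proof -
  have "comp_on D k (\<lambda>p xs. rec_nat (f p xs) (\<lambda>n y. (\<lambda>p zs. Suc (zs ! 1)) p (n # y # xs)) (g p xs))"
    by (rule comp_on_rec[where g = "\<lambda>p zs. Suc (zs ! 1)"]) (intro assms comp_on_Suc comp_on_nth; simp)+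
  moreover have "rec_nat a (\<lambda>n y. Suc y) m = a + m" for a m :: nat by (induction m) auto
  ultimately show ?thesis by simp
qed

lemma comp_on_diff:
  assumes "comp_on D k f" "comp_on D k g" shows "comp_on D k (\<lambda>p xs. f p xs - g p xs)"
proof -
  have "comp_on D k (\<lambda>p xs. rec_nat (f p xs) (\<lambda>n y. (\<lambda>p zs. zs ! 1 - 1) p (n # y # xs)) (g p xs))"
    by (rule comp_on_rec[where g = "\<lambda>p zs. zs ! 1 - 1"]) (intro assms comp_on_pred comp_on_nth; simp)+
  moreover have "rec_nat a (\<lambda>n y. y - 1) m = a - m" for a m :: nat by (induction m) auto
  ultimately show ?thesis by simp
qed

lemma comp_on_if0:
  assumes "comp_on D k c" "comp_on D k f" "comp_on D k g"
  shows "comp_on D k (\<lambda>p xs. if c p xs = 0 then f p xs else g p xs)"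
proof -
  \<comment> \<open>The case distinction is a recursion of length \<open>c\<close> that starts with
    \<open>f\<close> and whose step forgets the previous value: entry 4 of
    \<open>n # y # [c, f, g]\<close> is \<open>g\<close>.\<close>
  have h: "comp_on D (length [c, f, g])
      (\<lambda>p xs. rec_nat (xs ! 1) (\<lambda>n y. (\<lambda>p zs. zs ! 4) p (n # y # xs)) (xs ! 0))"
    by (rule comp_on_rec[where g = "\<lambda>p zs. zs ! 4"]) (auto intro: comp_on_nth)
  have "comp_on D k (\<lambda>p xs. rec_nat (f p xs) (\<lambda>n y. g p xs) (c p xs))"
    using comp_on_compose[OF h, of k] assms by (auto simp: numeral_eq_Suc)
  then show ?thesis
    by (rule comp_on_cong) (metis not0_implies_Suc old.nat.simps(6,7))
qed

lemma comp_on_if_le: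
  assumes "comp_on D k a" "comp_on D k b" "comp_on D k f" "comp_on D k g"
  shows "comp_on D k (\<lambda>p xs. if a p xs \<le> b p xs then f p xs else g p xs)"
  using comp_on_if0[OF comp_on_diff[OF assms(1,2)] assms(3,4)] by simp

lemma comp_on_if_eq:
  assumes "comp_on D k a" "comp_on D k b" "comp_on D k f" "comp_on D k g"
  shows "comp_on D k (\<lambda>p xs. if a p xs = b p xs then f p xs else g p xs)"
  by (rule comp_on_cong[OF comp_on_if_le[OF assms(1,2) comp_on_if_le[OF assms(2,1,3,4)] assms(4)]]) auto

lemma comp_on_half:
  assumes "comp_on D k f" shows "comp_on D k (\<lambda>p xs. f p xs div 2)"
proof -
  \<comment> \<open>The recursion works because \<open>n - n div 2 = Suc n div 2\<close>.\<close>
  have "comp_on D k (\<lambda>p xs. rec_nat 0 (\<lambda>n y. (\<lambda>p zs. zs ! 0 - zs ! 1) p (n # y # xs)) (f p xs))"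
    by (rule comp_on_rec[where g = "\<lambda>p zs. zs ! 0 - zs ! 1"])
      (intro assms comp_on_const comp_on_diff comp_on_nth; simp)+
  moreover have "rec_nat 0 (\<lambda>n y. n - y) m = m div 2" for m :: nat by (induction m) auto
  ultimately show ?thesis by simp
qed

lemma comp_on_if_even:
  assumes "comp_on D k a" "comp_on D k f" "comp_on D k g"
  shows "comp_on D k (\<lambda>p xs. if even (a p xs) then f p xs else g p xs)"
proof -
  note h = comp_on_half[OF assms(1)]
  show ?thesis
    \<comment> \<open>Evenness of \<open>a\<close> is tested as
      \<open>a \<le> a div 2 + a div 2\<close>.\<close>
    by (rule comp_on_cong[OF comp_on_if_le[OF assms(1) comp_on_add[OF h h] assms(2,3)]]) (auto elim: oddE)
qed

section \<open>Computability of the Cantor pairing and of its inverse\<close>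

lemma comp_on_triangle:
  assumes "comp_on D k f" shows "comp_on D k (\<lambda>p xs. triangle (f p xs))"
proof -
  have "comp_on D k (\<lambda>p xs. rec_nat 0 (\<lambda>n y. (\<lambda>p zs. zs ! 1 + Suc (zs ! 0)) p (n # y # xs)) (f p xs))"
    by (rule comp_on_rec[where g = "\<lambda>p zs. zs ! 1 + Suc (zs ! 0)"])
      (intro assms comp_on_const comp_on_add comp_on_Suc comp_on_nth; simp)+
  moreover have "rec_nat 0 (\<lambda>n y. y + Suc n) m = triangle m" for m :: nat by (induction m) auto
  ultimately show ?thesis by simp
qed

lemma cantor_pair_eq_triangle: "cantor_pair n k = triangle (n + k) + k"
  by (simp add: cantor_pair_def triangle_def)

lemma comp_on_cantor_pair:
  assumes "comp_on D k f" "comp_on D k g"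
  shows "comp_on D k (\<lambda>p xs. cantor_pair (f p xs) (g p xs))"
  unfolding cantor_pair_eq_triangle by (intro comp_on_add comp_on_triangle assms)

definition block :: "nat \<Rightarrow> nat" where "block m = snd (prod_decode m)"
definition offset :: "nat \<Rightarrow> nat" where "offset m = fst (prod_decode m)"

lemma block_cantor_pair [simp]: "block (cantor_pair n k) = n"
  by (simp add: block_def cantor_pair_eq_prod_encode)

lemma offset_cantor_pair [simp]: "offset (cantor_pair n k) = k"
  by (simp add: offset_def cantor_pair_eq_prod_encode)

lemma cantor_pair_block_offset [simp]: "cantor_pair (block m) (offset m) = m"
  by (simp add: block_def offset_def cantor_pair_eq_prod_encode)

text \<open>The sum is the number of the antidiagonal through \<open>m\<close>, and antidiagonal
  \<open>w\<close> starts at \<open>triangle w\<close>. Written as a least number it can be found by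
  an unbounded search; \<open>offset\<close> and \<open>block\<close> then follow by
  subtraction.\<close>

lemma block_plus_offset: "block m + offset m = (LEAST w. m < triangle (Suc w))"
proof -
  let ?w = "block m + offset m"
  have m: "m = triangle ?w + offset m"
    by (metis cantor_pair_block_offset cantor_pair_eq_triangle)
  have "(LEAST w. m < triangle (Suc w)) = ?w"
  proof (rule Least_equality)
    show "m < triangle (Suc ?w)" by (subst m) simp
    fix w assume w: "m < triangle (Suc w)"
    show "?w \<le> w"
    proof (rule ccontr)
      assume "\<not> ?w \<le> w"
      moreover have "mono triangle" by (rule incseq_SucI) simp
      ultimately have "triangle (Suc w) \<le> triangle ?w" by (simp only: mono_def not_le Suc_le_eq)
      with w m show False by linarith
    qed
  qed
  then show ?thesis by simp
qed

lemma comp_on_block_plus_offset: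
  assumes "comp_on D k f" shows "comp_on D k (\<lambda>p xs. block (f p xs) + offset (f p xs))"
proof -
  have "comp_on D 1 (\<lambda>p xs. LEAST m. (\<lambda>p zs. Suc (zs ! 1) - triangle (Suc (zs ! 0))) p (m # xs) = 0)"
  proof (rule comp_on_Least)
    fix xs :: "nat list"
    have "x \<le> triangle x" for x by (induction x) auto
    then have "Suc (xs ! 0) \<le> triangle (Suc (xs ! 0))" .
    then show "\<exists>m. Suc ((m # xs) ! 1) - triangle (Suc ((m # xs) ! 0)) = 0"
      by (intro exI[of _ "xs ! 0"]) (simp del: triangle_Suc)
  qed (intro comp_on_diff comp_on_Suc comp_on_triangle comp_on_nth; simp)
  from comp_on_compose1[OF this assms] show ?thesis
    unfolding block_plus_offset by (simp add: Suc_le_eq del: triangle_Suc)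
qed

lemma comp_on_offset:
  assumes "comp_on D k f" shows "comp_on D k (\<lambda>p xs. offset (f p xs))"
proof -
  have "offset m = m - triangle (block m + offset m)" for m
    by (metis cantor_pair_block_offset cantor_pair_eq_triangle add_diff_cancel_left')
  then show ?thesis
    by (rule comp_on_cong[OF comp_on_diff[OF assms comp_on_triangle[OF comp_on_block_plus_offset[OF assms]]]])
qed

lemma comp_on_block:
  assumes "comp_on D k f" shows "comp_on D k (\<lambda>p xs. block (f p xs))"
  by (rule comp_on_cong[OF comp_on_diff[OF comp_on_block_plus_offset[OF assms] comp_on_offset[OF assms]]]) simp

lemmas comp_on_intros = comp_on_nth comp_on_hd comp_on_Suc comp_on_query comp_on_const comp_on_add
  comp_on_diff comp_on_half comp_on_if_even comp_on_cantor_pair comp_on_offset comp_on_block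

lemma computable_funI:
  assumes "comp_on (dom F) 1 (\<lambda>p xs. the (F p) (xs ! 0))"
  shows "computable_fun F"
proof -
  from assms obtain e where e: "\<forall>p\<in>dom F. \<forall>xs. length xs = 1 \<longrightarrow> computes p e xs (the (F p) (xs ! 0))"
    unfolding comp_on_def by blast
  have "computes p e [n] (q n)" if "F p = Some q" for p q n
    using e[rule_format, of p "[n]"] that by force
  then show ?thesis unfolding computable_fun_def by blast
qed

lemma computable_totalI:
  assumes "comp_on UNIV 1 (\<lambda>p xs. \<phi> p (xs ! 0))"
  shows "computable_fun (\<lambda>p. Some (\<phi> p))"
  by (rule computable_funI) (use assms in \<open>simp add: dom_def\<close>)

section \<open>Closure properties of computable functions\<close>

text \<open>
  \<open>subst_oracle d k e\<close> turns a program \<open>e\<close> for \<open>k\<close> arguments into one for \<open>k + 1\<close> arguments whose last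
  argument \<open>n\<close> selects the oracle \<open>x \<mapsto> d(x, n)\<close>.
\<close>

fun subst_oracle :: "prog \<Rightarrow> nat \<Rightarrow> prog \<Rightarrow> prog" where
  "subst_oracle d k Zero = Zero"
| "subst_oracle d k Succ = Comp Succ [Proj 0]"
| "subst_oracle d k Query = d"
| "subst_oracle d k (Proj i) = Proj i"
| "subst_oracle d k (Comp f gs) =
    Comp (subst_oracle d (length gs) f) (map (subst_oracle d k) gs @ [Proj k])"
| "subst_oracle d k (PrimRec f g) = PrimRec (subst_oracle d (k - 1) f) (subst_oracle d (Suc k) g)"
| "subst_oracle d k (Mu f) = Mu (subst_oracle d (Suc k) f)"

text \<open>The parameter \<open>n\<close> allows one program to act on every component of a
  sequence, the component being the oracle. It stands last because recursion and search add their
  variables in front and so leave it in place.\<close>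

lemma computes_subst_oracle:
  assumes "computes q e xs y" and d: "\<And>x. computes p d [x, n] (q x)"
  shows "computes p (subst_oracle d (length xs) e) (xs @ [n]) y"
  using assms(1)
proof (induction e xs y rule: computes.induct)
  case (Zero xs)
  show ?case by (simp add: computes.Zero)
next
  case (Succ x)
  have "computes p (Proj 0) [x, n] x" using computes.Proj[of 0 "[x, n]" p] by simp
  then show ?case by (auto intro!: computes.Comp computes.Succ)
next
  case (Query x)
  show ?case by (simp add: d)
next
  case (Proj i xs)
  then show ?case using computes.Proj[of i "xs @ [n]" p] by (simp add: nth_append)
next
  case (Comp xs gs ys f z)
  have len: "length gs = length ys" using Comp.IH(1) by (rule list_all2_lengthD)
  have "list_all2 (\<lambda>g y. computes p g (xs @ [n]) y)
      (map (subst_oracle d (length xs)) gs @ [Proj (length xs)]) (ys @ [n])"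
    using Comp.IH(1) computes.Proj[of "length xs" "xs @ [n]" p]
    by (auto simp: list_all2_conv_all_nth nth_append)
  with Comp.IH(2) show ?case by (auto simp: len intro: computes.Comp)
next
  case (PrimRec_0 f xs z g)
  then show ?case by (auto intro: computes.PrimRec_0)
next
  case (PrimRec_Suc f g m xs y z)
  then show ?case by (auto intro: computes.PrimRec_Suc)
next
  case (Mu f m xs)
  then show ?case by (auto intro!: computes.Mu)
qed

lemma computable_funE:
  assumes "computable_fun F"
  obtains e where "\<And>p q n. F p = Some q \<Longrightarrow> computes p e [n] (q n)"
  using assms unfolding computable_fun_def by blast

lemma computable_fun_comp:
  assumes "computable_fun F" "computable_fun G"
  shows "computable_fun (F \<circ>\<^sub>m G)"
proof -
  obtain e where e: "\<And>p q n. F p = Some q \<Longrightarrow> computes p e [n] (q n)"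
    using computable_funE[OF assms(1)] by blast
  obtain d where d: "\<And>p q n. G p = Some q \<Longrightarrow> computes p d [n] (q n)"
    using computable_funE[OF assms(2)] by blast
  \<comment> \<open>For plain composition the oracle needs no parameter, so a dummy 0 is passed and
    \<open>Comp d [Proj 0]\<close> ignores it.\<close>
  let ?e = "Comp (subst_oracle (Comp d [Proj 0]) 1 e) [Proj 0, Zero]"
  have "computes p ?e [n] (q n)" if q: "(F \<circ>\<^sub>m G) p = Some q" for p q n
  proof -
    from q obtain r where r: "G p = Some r" "F r = Some q"
      by (auto simp: map_comp_Some_iff)
    have proj: "computes p (Proj 0) (x # ys) x" for x ys
      using computes.Proj[of 0 "x # ys" p] by simp
    have "computes p (Comp d [Proj 0]) [x, 0] (r x)" for x
      using d[OF r(1)] proj by (auto intro!: computes.Comp)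
    from computes_subst_oracle[OF e[OF r(2)] this]
    have "computes p (subst_oracle (Comp d [Proj 0]) 1 e) [n, 0] (q n)" by simp
    then show ?thesis using proj by (auto intro!: computes.Comp computes.Zero)
  qed
  then show ?thesis unfolding computable_fun_def by blast
qed

definition baire_tuple :: "(nat \<Rightarrow> baire) \<Rightarrow> baire" where
  "baire_tuple p = (\<lambda>m. p (block m) (offset m))"

lemma component_baire_tuple [simp]: "component (baire_tuple p) n = p n"
  by (simp add: component_def baire_tuple_def)

text \<open>\<open>seq_rep F\<close> reads the partial function \<open>F\<close> as a representation
  by points of Baire space; the result is therefore defined only where \<open>F\<close> is defined
  at all components.\<close>

definition map_components :: "(baire \<rightharpoonup> baire) \<Rightarrow> (baire \<rightharpoonup> baire)" where
  "map_components F p = map_option baire_tuple (seq_rep F p)"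

lemma seq_rep_eq_Some_iff: "seq_rep \<delta> p = Some x \<longleftrightarrow> (\<forall>n. \<delta> (component p n) = Some (x n))"
  unfolding seq_rep_def by (auto simp: dom_def; metis option.sel option.distinct(1))

lemma map_components_eq_Some_iff:
  "map_components F p = Some q \<longleftrightarrow> (\<forall>n. F (component p n) = Some (component q n))"
proof -
  have "q = baire_tuple (component q)"
    by (simp add: baire_tuple_def component_def)
  then show ?thesis
    unfolding map_components_def
    by (auto simp: seq_rep_eq_Some_iff intro: exI[of _ "component q"])
qed

lemma computable_fun_map_components:
  assumes "computable_fun F"
  shows "computable_fun (map_components F)"
proof -
  obtain e where e: "\<And>p q n. F p = Some q \<Longrightarrow> computes p e [n] (q n)"
    using computable_funE[OF assms] by blast
  have "comp_on UNIV 2 (\<lambda>p xs. p (cantor_pair (xs ! 1) (xs ! 0)))"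
    by (intro comp_on_intros) simp_all
  then obtain d where "\<forall>p. \<forall>xs. length xs = 2 \<longrightarrow> computes p d xs (p (cantor_pair (xs ! 1) (xs ! 0)))"
    unfolding comp_on_def by blast
  then have d: "computes p d [x, n] (component p n x)" for p x n
    by (elim allE[of _ p] allE[of _ "[x, n]"]) (simp add: component_def)
  have "comp_on UNIV 1 (\<lambda>p xs. block (xs ! 0))" "comp_on UNIV 1 (\<lambda>p xs. offset (xs ! 0))"
    by (intro comp_on_intros; simp)+
  then obtain eb eo where
    eb: "\<forall>p xs. length xs = 1 \<longrightarrow> computes p eb xs (block (xs ! 0))" and
    eo: "\<forall>p xs. length xs = 1 \<longrightarrow> computes p eo xs (offset (xs ! 0))"
    unfolding comp_on_def by blast
  have ebo: "computes p eb [m] (block m)" "computes p eo [m] (offset m)" for p m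
    using eb[rule_format, where xs = "[m]"] eo[rule_format, where xs = "[m]"] by simp_all
  let ?e = "Comp (subst_oracle d 1 e) [eo, eb]"
  have "computes p ?e [m] (q m)" if "map_components F p = Some q" for p q m
  proof -
    have "F (component p (block m)) = Some (component q (block m))"
      using that by (simp add: map_components_eq_Some_iff)
    from computes_subst_oracle[OF e[OF this] d, of "offset m"]
    have "computes p (subst_oracle d 1 e) [offset m, block m] (q m)"
      by (simp add: component_def)
    then show ?thesis using ebo by (auto intro!: computes.Comp)
  qed
  then show ?thesis unfolding computable_fun_def by blast
qed

definition fun_pair :: "(baire \<rightharpoonup> baire) \<Rightarrow> (baire \<rightharpoonup> baire) \<Rightarrow> (baire \<rightharpoonup> baire)" where
  "fun_pair F G p = (case (F p, G p) of (Some a, Some b) \<Rightarrow> Some (baire_pair a b) | _ \<Rightarrow> None)"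

lemma fun_pair_eq_Some_iff:
  "fun_pair F G p = Some r \<longleftrightarrow> (\<exists>a b. F p = Some a \<and> G p = Some b \<and> r = baire_pair a b)"
  unfolding fun_pair_def by (auto split: option.splits)

lemma comp_on_of_computable_fun:
  assumes "computable_fun F" "D \<subseteq> dom F" "comp_on D k a"
  shows "comp_on D k (\<lambda>p xs. the (F p) (a p xs))"
proof -
  obtain e where e: "\<And>p q n. F p = Some q \<Longrightarrow> computes p e [n] (q n)"
    using computable_funE[OF assms(1)] by blast
  have "comp_on D 1 (\<lambda>p xs. the (F p) (xs ! 0))"
    unfolding comp_on_def
  proof (intro exI[of _ e] ballI allI impI)
    fix p and xs :: "nat list" assume "p \<in> D" "length xs = 1"
    then obtain q n where "F p = Some q" "xs = [n]" 
      using assms(2) by (auto simp: length_Suc_conv)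
    with e show "computes p e xs (the (F p) (xs ! 0))" by simp
  qed
  from comp_on_compose1[OF this assms(3)] show ?thesis by simp
qed

lemma computable_fun_pair:
  assumes "computable_fun F" "computable_fun G"
  shows "computable_fun (fun_pair F G)"
proof (rule computable_funI)
  let ?D = "dom (fun_pair F G)"
  have sub: "?D \<subseteq> dom F" "?D \<subseteq> dom G"
    by (auto simp: fun_pair_eq_Some_iff)
  have "comp_on ?D 1 (\<lambda>p xs. if even (xs ! 0) then the (F p) (xs ! 0 div 2) else the (G p) (xs ! 0 div 2))"
    by (intro comp_on_intros comp_on_of_computable_fun assms sub) simp_all
  then show "comp_on ?D 1 (\<lambda>p xs. the (fun_pair F G p) (xs ! 0))"
    by (rule comp_on_cong) (auto simp: fun_pair_def baire_pair_def split: option.splits)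
qed

lemma computable_fun_minus_one: "computable_fun minus_one"
proof (rule computable_funI)
  let ?D = "{p :: baire. infinite {n. p n \<noteq> 0}}"
  let ?enum = "\<lambda>p :: baire. enumerate {n. p n \<noteq> 0}"
  let ?f = "\<lambda>p zs. 1 - p (zs ! 0) :: nat"
  \<comment> \<open>The searched predicate is 0 exactly at a nonzero entry of \<open>p\<close>. The
    arguments of \<open>?g\<close> are the candidate, the recursion counter, the previous position
    and the index asked for, so \<open>zs ! 2\<close> is the previous position.\<close>
  let ?g = "\<lambda>p zs. if zs ! 0 \<le> zs ! 2 then 1 else 1 - p (zs ! 0) :: nat"
  have D: "dom minus_one = ?D" by (auto simp: minus_one_def dom_def)
  have first: "comp_on ?D 1 (\<lambda>p xs. LEAST m. ?f p (m # xs) = 0)"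
  proof (rule comp_on_Least)
    show "comp_on ?D (Suc 1) ?f" by (intro comp_on_intros) simp
    fix p :: baire and xs :: "nat list" assume "p \<in> ?D"
    then obtain m where "p m \<noteq> 0" using infinite_imp_nonempty by blast
    then show "\<exists>m. ?f p (m # xs) = 0" by (intro exI[of _ m]) simp
  qed
  have next_pos: "comp_on ?D 3 (\<lambda>p xs. LEAST m. ?g p (m # xs) = 0)"
  proof (rule comp_on_Least)
    show "comp_on ?D (Suc 3) ?g" by (intro comp_on_if_le comp_on_intros) simp_all
    fix p :: baire and xs :: "nat list" assume "p \<in> ?D"
    then have "\<exists>m>xs ! 1. m \<in> {n. p n \<noteq> 0}"
      unfolding mem_Collect_eq infinite_nat_iff_unbounded by blast
    then obtain m where "m > xs ! 1" "p m \<noteq> 0" by blast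
    then show "\<exists>m. ?g p (m # xs) = 0"
      by (intro exI[of _ m]) (auto simp: numeral_2_eq_2)
  qed
  have rec: "comp_on ?D 1 (\<lambda>p xs. rec_nat (LEAST m. ?f p (m # xs) = 0)
      (\<lambda>n y. (\<lambda>p ys. LEAST m. ?g p (m # ys) = 0) p (n # y # xs)) (xs ! 0))"
  proof (rule comp_on_rec[where g = "\<lambda>p ys. LEAST m. ?g p (m # ys) = 0"])
    show "comp_on ?D (Suc (Suc 1)) (\<lambda>p ys. LEAST m. ?g p (m # ys) = 0)"
      using next_pos by (simp only: numeral_3_eq_3 One_nat_def)
  qed (simp_all only: first comp_on_nth zero_less_one)
  have rec_eq: "rec_nat (LEAST m. ?f p (m # xs) = 0)
      (\<lambda>n y. (\<lambda>p ys. LEAST m. ?g p (m # ys) = 0) p (n # y # xs)) k = ?enum p k"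
    if "p \<in> ?D" for p xs k
  proof (induction k)
    case 0
    show ?case by (simp add: enumerate_0 Suc_le_eq)
  next
    case (Suc k)
    show ?case
      unfolding enumerate_Suc''[OF that[unfolded mem_Collect_eq]] old.nat.simps(7) Suc
      by (rule arg_cong[of _ _ Least]) (auto simp: fun_eq_iff)
  qed
  have "comp_on ?D 1 (\<lambda>p xs. ?enum p (xs ! 0))"
    by (rule comp_on_cong[OF rec]) (rule rec_eq[symmetric])
  then have "comp_on ?D 1 (\<lambda>p xs. p (?enum p (xs ! 0)) - 1)"
    by (intro comp_on_pred comp_on_query)
  then show "comp_on (dom minus_one) 1 (\<lambda>p xs. the (minus_one p) (xs ! 0))"
    unfolding D by (rule comp_on_cong) (simp add: minus_one_def)
qed

section \<open>Lifting partial functions to completions\<close>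

text \<open>\<open>t s n\<close> is meant as the knowledge of stage \<open>s\<close> about entry
  \<open>n\<close>: 0 for none, otherwise the entry plus one. The number of entries emitted before
  stage \<open>s\<close> is then the index of the entry due next. Keeping \<open>t\<close> abstract
  lets computable and continuous functions share the construction.\<close>

primrec emitted :: "(nat \<Rightarrow> nat \<Rightarrow> nat) \<Rightarrow> nat \<Rightarrow> nat" where
  "emitted t 0 = 0"
| "emitted t (Suc s) = (if t s (emitted t s) = 0 then emitted t s else Suc (emitted t s))"

definition emit :: "(nat \<Rightarrow> nat \<Rightarrow> nat) \<Rightarrow> baire" where
  "emit t s = t s (emitted t s)"

lemma emitted_eq_card: "emitted t s = card ({s. emit t s \<noteq> 0} \<inter> {..<s})"
proof (induction s)
  case (Suc s)
  have "{s. emit t s \<noteq> 0} \<inter> {..<Suc s} =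
    (if emit t s = 0 then {s. emit t s \<noteq> 0} \<inter> {..<s}
     else insert s ({s. emit t s \<noteq> 0} \<inter> {..<s}))"
    by (auto simp: less_Suc_eq)
  with Suc show ?case by (simp add: emit_def)
qed simp

text \<open>Connects two ways of counting: \<open>emitted\<close> counts the nonzero stages so far,
  while \<open>minus_one\<close> enumerates them.\<close>

lemma card_enumerate_lessThan:
  fixes S :: "nat set"
  assumes "infinite S"
  shows "card (S \<inter> {..<enumerate S k}) = k"
proof -
  have "S \<inter> {..<enumerate S k} = enumerate S ` {..<k}"
  proof (intro equalityI subsetI)
    fix x assume x: "x \<in> S \<inter> {..<enumerate S k}"
    then obtain n where "enumerate S n = x" using enumerate_Ex[OF assms, of x] by blast
    with x show "x \<in> enumerate S ` {..<k}" by (auto simp: assms)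
  qed (auto simp: assms enumerate_in_set)
  then show ?thesis
    using inj_enumerate[OF assms] by (simp add: card_image inj_on_subset)
qed

text \<open>If the counter never got past \<open>n\<close>, it would wait at \<open>n\<close>
  forever, although entry \<open>n\<close> is known at all late stages. That knowledge persists is
  essential, since an entry may become known long before its turn. As no stage reports a wrong
  entry, what is emitted is \<open>q\<close> in order.\<close>

lemma minus_one_emit:
  assumes "\<And>n. \<forall>\<^sub>F s in sequentially. t s n = Suc (q n)"
    and "\<And>s n. t s n = 0 \<or> t s n = Suc (q n)"
  shows "minus_one (emit t) = Some q"
proof -
  let ?S = "{s. emit t s \<noteq> 0}"
  have ex: "\<exists>s. emitted t s = n" for n
  proof (induction n)
    case 0
    show ?case by (rule exI[of _ 0]) simp
  next
    case (Suc n)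
    then obtain s0 where s0: "emitted t s0 = n" by blast
    show ?case
    proof (rule ccontr)
      assume contr: "\<nexists>s. emitted t s = Suc n"
      have "emitted t (s0 + d) = n" for d
      proof (induction d)
        case (Suc d)
        then show ?case using contr by (metis add_Suc_right emitted.simps(2))
      qed (simp add: s0)
      then have const: "emitted t s = n" if "s \<ge> s0" for s
        using that le_Suc_ex by blast
      obtain s1 where "t s n = Suc (q n)" if "s \<ge> s1" for s
        using assms(1) by (auto simp: eventually_sequentially)
      then have "emitted t (Suc (max s0 s1)) = Suc n"
        using const[of "max s0 s1"] by simp
      with contr show False by blast
    qed
  qed
  have inf: "infinite ?S"
  proof
    assume "finite ?S"
    then have "emitted t s \<le> card ?S" for s
      unfolding emitted_eq_card by (simp add: card_mono)
    moreover obtain s where "emitted t s = Suc (card ?S)" using ex by blast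
    ultimately show False by (metis not_less_eq_eq order_refl)
  qed
  have "emit t (enumerate ?S k) - 1 = q k" for k
  proof -
    have "emitted t (enumerate ?S k) = k"
      unfolding emitted_eq_card by (rule card_enumerate_lessThan[OF inf])
    moreover have "emit t (enumerate ?S k) \<noteq> 0"
      using enumerate_in_set[OF inf, of k] by simp
    ultimately show ?thesis
      using assms(2)[of "enumerate ?S k" k] by (auto simp: emit_def)
  qed
  with inf show ?thesis by (simp add: minus_one_def)
qed

text \<open>
  \<open>approx p s e xs\<close> is \<open>y + 1\<close> if \<open>e\<close> computes \<open>y\<close> when all unbounded searches are cut off at \<open>s\<close>,
  and \<open>0\<close> if this fails.
\<close>

fun approx :: "baire \<Rightarrow> nat \<Rightarrow> prog \<Rightarrow> nat list \<Rightarrow> nat" where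
  "approx p s Zero xs = 1"
| "approx p s Succ xs = (if length xs = 1 then Suc (Suc (hd xs)) else 0)"
| "approx p s Query xs = (if length xs = 1 then Suc (p (hd xs)) else 0)"
| "approx p s (Proj i) xs = (if i < length xs then Suc (xs ! i) else 0)"
| "approx p s (Comp f gs) xs = (if \<forall>g\<in>set gs. approx p s g xs \<noteq> 0
     then approx p s f (map (\<lambda>g. approx p s g xs - 1) gs) else 0)"
| "approx p s (PrimRec f g) xs = (if xs = [] then 0 else
     rec_nat (approx p s f (tl xs))
       (\<lambda>n y. if y = 0 then 0 else approx p s g (n # (y - 1) # tl xs)) (hd xs))"
| "approx p s (Mu f) xs = (if approx p s f ((LEAST m. approx p s f (m # xs) \<le> 1 \<or> s \<le> m) # xs) = 1
     then Suc (LEAST m. approx p s f (m # xs) \<le> 1 \<or> s \<le> m) else 0)"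

text \<open>A cutoff can lose an answer but not change it, and a terminating computation has only
  finitely many subcomputations, all of which succeed for large \<open>s\<close>. In a search, a
  candidate whose evaluation fails also stops the scan, and the final test for the value 1 rejects
  it; otherwise a later zero could be taken for the first one.\<close>

lemma approx_computes:
  assumes "computes p e xs y"
  shows "(\<forall>s. approx p s e xs = 0 \<or> approx p s e xs = Suc y) \<and>
    (\<forall>\<^sub>F s in sequentially. approx p s e xs = Suc y)"
  using assms
proof (induction e xs y rule: computes.induct)
  case (Comp xs gs ys f z)
  have ys: "map (\<lambda>g. approx p s g xs - 1) gs = ys" if "\<forall>g\<in>set gs. approx p s g xs \<noteq> 0" for s
  proof (rule nth_equalityI)
    show "length (map (\<lambda>g. approx p s g xs - 1) gs) = length ys"
      using list_all2_lengthD[OF Comp.IH(1)] by simp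
    fix i assume "i < length (map (\<lambda>g. approx p s g xs - 1) gs)"
    then have i: "i < length gs" by simp
    then have "approx p s (gs ! i) xs = Suc (ys ! i)"
      using list_all2_nthD[OF Comp.IH(1) i] that nth_mem[OF i] by metis
    with i show "map (\<lambda>g. approx p s g xs - 1) gs ! i = ys ! i" by simp
  qed
  have Comp_True: "approx p s (Comp f gs) xs = approx p s f ys"
    if "\<forall>g\<in>set gs. approx p s g xs \<noteq> 0" for s
    unfolding approx.simps if_P[OF that] ys[OF that] ..
  have Comp_False: "approx p s (Comp f gs) xs = 0"
    if "\<not> (\<forall>g\<in>set gs. approx p s g xs \<noteq> 0)" for s
    unfolding approx.simps if_not_P[OF that] ..
  have "\<forall>\<^sub>F s in sequentially. \<forall>g\<in>set gs. approx p s g xs \<noteq> 0"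
  proof (intro eventually_ball_finite ballI finite_set)
    fix g assume "g \<in> set gs"
    then obtain y where "\<forall>\<^sub>F s in sequentially. approx p s g xs = Suc y"
      using Comp.IH(1) by (auto simp: in_set_conv_nth list_all2_conv_all_nth)
    then show "\<forall>\<^sub>F s in sequentially. approx p s g xs \<noteq> 0"
      by eventually_elim simp
  qed
  moreover have "\<forall>\<^sub>F s in sequentially. approx p s f ys = Suc z"
    using Comp.IH(2) by blast
  ultimately have "\<forall>\<^sub>F s in sequentially. approx p s (Comp f gs) xs = Suc z"
    by eventually_elim (simp only: Comp_True)
  moreover have "approx p s (Comp f gs) xs = 0 \<or> approx p s (Comp f gs) xs = Suc z" for s
    using Comp_True[of s] Comp_False[of s] Comp.IH(2) by metis
  ultimately show ?case by blast
next
  case (PrimRec_Suc f g n xs y z)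
  have step: "approx p s (PrimRec f g) (Suc n # xs) = (if approx p s (PrimRec f g) (n # xs) = 0 then 0
     else approx p s g (n # (approx p s (PrimRec f g) (n # xs) - 1) # xs))" for s
    by (simp cong: if_cong)
  have "\<forall>\<^sub>F s in sequentially. approx p s (PrimRec f g) (Suc n # xs) = Suc z"
    using conjunct2[OF PrimRec_Suc.IH(1)] conjunct2[OF PrimRec_Suc.IH(2)]
    by eventually_elim (simp add: step del: approx.simps)
  moreover have "approx p s (PrimRec f g) (Suc n # xs) = 0 \<or>
      approx p s (PrimRec f g) (Suc n # xs) = Suc z" for s
    using PrimRec_Suc.IH unfolding step by (metis diff_Suc_1)
  ultimately show ?case by blast
next
  case (Mu f n xs)
  let ?L = "\<lambda>s. LEAST m. approx p s f (m # xs) \<le> 1 \<or> s \<le> m"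
  have "approx p s (Mu f) xs = 0 \<or> approx p s (Mu f) xs = Suc n" for s
  proof -
    have "?L s = n" if *: "approx p s f (?L s # xs) = 1"
    proof (rule antisym)
      have "approx p s f (n # xs) \<le> 1" using Mu.IH(1) by (metis One_nat_def le_SucI order_refl zero_le)
      then show "?L s \<le> n" by (intro Least_le disjI1)
      show "n \<le> ?L s"
      proof (rule ccontr)
        assume "\<not> n \<le> ?L s"
        then obtain y where "approx p s f (?L s # xs) = 0 \<or> approx p s f (?L s # xs) = Suc (Suc y)"
          using Mu.IH(2) by (meson not_le)
        with * show False by auto
      qed
    qed
    then show ?thesis by auto
  qed
  moreover have "\<forall>\<^sub>F s in sequentially. approx p s (Mu f) xs = Suc n"
  proof -
    have "\<forall>\<^sub>F s in sequentially. \<forall>m\<in>{..<n}. approx p s f (m # xs) > 1"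
    proof (intro eventually_ball_finite ballI finite_lessThan)
      fix m assume "m \<in> {..<n}"
      then obtain y where "\<forall>\<^sub>F s in sequentially. approx p s f (m # xs) = Suc (Suc y)"
        using Mu.IH(2) by auto
      then show "\<forall>\<^sub>F s in sequentially. approx p s f (m # xs) > 1"
        by eventually_elim simp
    qed
    moreover have "\<forall>\<^sub>F s in sequentially. approx p s f (n # xs) = Suc 0"
      using Mu.IH(1) by blast
    \<comment> \<open>A cutoff of at least \<open>n\<close> ensures that the clause
      \<open>s \<le> m\<close> does not end the search before \<open>n\<close>.\<close>
    ultimately show ?thesis using eventually_ge_at_top[of n]
    proof eventually_elim
      case (elim s)
      have "?L s = n"
      proof (rule Least_equality)
        show "approx p s f (n # xs) \<le> 1 \<or> s \<le> n" using elim by simp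
        fix m assume "approx p s f (m # xs) \<le> 1 \<or> s \<le> m"
        then show "n \<le> m" using elim by (metis lessThan_iff not_le order_trans)
      qed
      with elim show ?case by simp
    qed
  qed
  ultimately show ?case by blast
qed simp_all

text \<open>The program \<open>e\<close> is fixed, so its bounded evaluation unfolds along the
  structure of \<open>e\<close> into total computable operations; no coding of programs and no
  universal program are involved. The cutoff is the last argument, which leaves the front free for
  recursion and search variables.\<close>

lemma comp_on_approx: "comp_on UNIV (Suc k) (\<lambda>p xs. approx p (last xs) e (butlast xs))"
proof (induction e arbitrary: k)
  case Zero
  show ?case by (simp add: comp_on_const)
next
  case Succ
  show ?case
  proof (cases "k = 1")
    case True
    have "comp_on UNIV (Suc k) (\<lambda>p xs. Suc (Suc (hd xs)))" by (intro comp_on_intros) simp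
    then show ?thesis by (rule comp_on_cong) (auto simp: True length_Suc_conv)
  qed (rule comp_on_cong[OF comp_on_const[of _ _ 0]], simp)
next
  case Query
  show ?case
  proof (cases "k = 1")
    case True
    have "comp_on UNIV (Suc k) (\<lambda>p xs. Suc (p (hd xs)))" by (intro comp_on_intros) simp
    then show ?thesis by (rule comp_on_cong) (auto simp: True length_Suc_conv)
  qed (rule comp_on_cong[OF comp_on_const[of _ _ 0]], simp)
next
  case (Proj i)
  show ?case
  proof (cases "i < k")
    case True
    have "comp_on UNIV (Suc k) (\<lambda>p xs. Suc (xs ! i))" using True by (intro comp_on_intros) simp
    then show ?thesis by (rule comp_on_cong) (auto simp: True nth_butlast)
  qed (rule comp_on_cong[OF comp_on_const[of _ _ 0]], simp)
next
  case (Comp f gs)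
  let ?G = "\<lambda>g p xs. approx p (last xs) g (butlast xs)"
  have all: "comp_on UNIV (Suc k) (\<lambda>p xs. of_bool (\<forall>g\<in>set hs. ?G g p xs \<noteq> 0))" if "set hs \<subseteq> set gs" for hs
    using that
  proof (induction hs)
    case Nil
    show ?case by (simp add: comp_on_const)
  next
    case (Cons h hs)
    then have "comp_on UNIV (Suc k) (\<lambda>p xs. if ?G h p xs = 0 then 0
        else of_bool (\<forall>g\<in>set hs. ?G g p xs \<noteq> 0))"
      by (intro comp_on_if0 comp_on_const Comp.IH(2) Cons.IH) auto
    then show ?case by (rule comp_on_cong) auto
  qed
  have "comp_on UNIV (Suc k) (\<lambda>p xs. ?G f p (map (\<lambda>h. h p xs)
      (map (\<lambda>g p xs. ?G g p xs - 1) gs @ [\<lambda>p xs. last xs])))"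
    by (rule comp_on_compose) (auto intro!: Comp.IH comp_on_pred[unfolded One_nat_def] comp_on_last)
  then have "comp_on UNIV (Suc k) (\<lambda>p xs. approx p (last xs) f (map (\<lambda>g. ?G g p xs - 1) gs))"
    by (simp add: o_def)
  from comp_on_if0[OF all[OF order_refl] comp_on_const[of _ _ 0] this]
  show ?case by (rule comp_on_cong) auto
next
  case (PrimRec f g)
  show ?case
  proof (cases k)
    case 0
    then show ?thesis by (intro comp_on_cong[OF comp_on_const[of _ _ 0]]) (auto simp: length_Suc_conv)
  next
    case (Suc j)
    let ?F = "\<lambda>p xs. approx p (last xs) f (butlast (tl xs))"
    \<comment> \<open>The list \<open>zs\<close> consists of the counter, the value so far increased
      by one, and the original arguments; dropping three entries also removes the original recursion
      bound.\<close>
    let ?G = "\<lambda>p zs. if zs ! 1 = 0 then 0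
      else (\<lambda>p xs. approx p (last xs) g (butlast xs)) p (zs ! 0 # (zs ! 1 - 1) # drop 3 zs)"
    have tl: "comp_on UNIV (Suc (Suc j)) (\<lambda>p xs. h p (tl xs))" if "comp_on UNIV (Suc j) h" for h
    proof -
      have "comp_on UNIV (Suc (Suc j)) (\<lambda>p xs. h p (map (\<lambda>h. h p xs) (map (\<lambda>i p xs. xs ! Suc i) [0..<Suc j])))"
        using that by (intro comp_on_compose) (auto intro: comp_on_nth)
      then show ?thesis
        by (rule comp_on_cong) (auto simp: o_def intro!: arg_cong[of _ _ "h _"] nth_equalityI simp: nth_tl simp del: upt_Suc)
    qed
    have f: "comp_on UNIV (Suc (Suc j)) ?F"
      by (rule comp_on_cong[OF tl[OF PrimRec.IH(1)]]) (auto simp: length_Suc_conv)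
    let ?sel = "(\<lambda>p zs. zs ! 0) # (\<lambda>p zs. zs ! 1 - 1) # map (\<lambda>i p zs. zs ! (i + 3)) [0..<Suc j]"
    have sel: "comp_on UNIV (Suc (Suc (Suc (Suc j))))
        (\<lambda>p zs. (\<lambda>p xs. approx p (last xs) g (butlast xs)) p (map (\<lambda>h. h p zs) ?sel))"
      using PrimRec.IH(2)[of "Suc (Suc j)"]
      by (intro comp_on_compose) (auto intro!: comp_on_nth comp_on_pred[unfolded One_nat_def])
    have sel_eq: "map (\<lambda>h. h p zs) ?sel = zs ! 0 # (zs ! 1 - 1) # drop 3 zs"
      if "length zs = Suc (Suc (Suc (Suc j)))" for p :: baire and zs :: "nat list"
      using that by (auto simp: o_def add.commute intro!: nth_equalityI simp del: upt_Suc)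
    have "comp_on UNIV (Suc (Suc (Suc (Suc j)))) (\<lambda>p zs.
        (\<lambda>p xs. approx p (last xs) g (butlast xs)) p (zs ! 0 # (zs ! 1 - 1) # drop 3 zs))"
      by (rule comp_on_cong[OF sel]) (simp only: sel_eq)
    then have "comp_on UNIV (Suc (Suc (Suc (Suc j)))) ?G"
      by (intro comp_on_if0 comp_on_const comp_on_nth) simp_all
    from f this have "comp_on UNIV (Suc (Suc j)) (\<lambda>p xs. rec_nat (?F p xs) (\<lambda>n y. ?G p (n # y # xs)) (hd xs))"
      by (rule comp_on_rec[where g = ?G]) (simp add: comp_on_hd)
    then show ?thesis unfolding Suc
      by (rule comp_on_cong) (auto simp: length_Suc_conv eval_nat_numeral cong: if_cong)
  qed
next
  case (Mu f)
  let ?A = "\<lambda>p zs. approx p (last zs) f (butlast zs)"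
  \<comment> \<open>The second branch vanishes once the candidate reaches the cutoff, so this search
    always ends.\<close>
  let ?T = "\<lambda>p zs. if ?A p zs \<le> 1 then 0 else last zs - zs ! 0"
  have A: "comp_on UNIV (Suc (Suc k)) ?A" by (rule Mu.IH)
  have "comp_on UNIV (Suc k) (\<lambda>p xs. LEAST m. ?T p (m # xs) = 0)"
  proof (rule comp_on_Least)
    show "comp_on UNIV (Suc (Suc k)) ?T"
      using A by (intro comp_on_if_le comp_on_intros comp_on_last) simp_all
    fix p :: baire and xs :: "nat list"
    show "\<exists>m. ?T p (m # xs) = 0" if "length xs = Suc k"
      by (rule exI[of _ "last xs"]) (use that in auto)
  qed
  then have L: "comp_on UNIV (Suc k) (\<lambda>p xs. LEAST m. approx p (last xs) f (m # butlast xs) \<le> 1 \<or> last xs \<le> m)"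
    by (rule comp_on_cong) (auto intro!: arg_cong[of _ _ Least] simp: fun_eq_iff)
  let ?L = "\<lambda>p xs. LEAST m. approx p (last xs) f (m # butlast xs) \<le> 1 \<or> last xs \<le> m"
  let ?sel = "?L # map (\<lambda>i p zs. zs ! i) [0..<Suc k]"
  have "comp_on UNIV (Suc k) (\<lambda>p xs. ?A p (map (\<lambda>h. h p xs) ?sel))"
    using A L by (intro comp_on_compose) (auto intro: comp_on_nth)
  then have "comp_on UNIV (Suc k) (\<lambda>p xs. ?A p (?L p xs # xs))"
  proof (rule comp_on_cong)
    fix p :: baire and xs :: "nat list" assume len: "length xs = Suc k"
    have "map (\<lambda>h. h p xs) ?sel = ?L p xs # xs"
      by (simp add: o_def map_nth len[symmetric] del: upt_Suc)
    then show "?A p (?L p xs # xs) = ?A p (map (\<lambda>h. h p xs) ?sel)"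
      by (simp only:)
  qed
  then have "comp_on UNIV (Suc k) (\<lambda>p xs. if ?A p (?L p xs # xs) = 1 then Suc (?L p xs) else 0)"
    using L by (intro comp_on_if_eq comp_on_const comp_on_Suc)
  then show ?case
  proof (rule comp_on_cong)
    fix p :: baire and xs :: "nat list" assume "length xs = Suc k"
    then have "xs \<noteq> []" by auto
    then show "approx p (last xs) (Mu f) (butlast xs) =
        (if ?A p (?L p xs # xs) = 1 then Suc (?L p xs) else 0)"
      unfolding approx.simps last.simps butlast.simps by (simp only: if_False)
  qed
qed

lemma computable_fun_lift:
  assumes "computable_fun F"
  shows "\<exists>L. computable_fun (\<lambda>p. Some (L p)) \<and> (\<forall>p q. F p = Some q \<longrightarrow> minus_one (L p) = Some q)"
proof -
  obtain e where e: "\<And>p q n. F p = Some q \<Longrightarrow> computes p e [n] (q n)"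
    using computable_funE[OF assms] by blast
  let ?t = "\<lambda>p s n. approx p s e [n]"
  have A: "comp_on UNIV k (\<lambda>p xs. ?t p (b p xs) (a p xs))" if "comp_on UNIV k a" "comp_on UNIV k b" for k a b
    using comp_on_compose2[of UNIV "\<lambda>p xs. approx p (last xs) e (butlast xs)" k a b]
      comp_on_approx[of 1 e] that by (simp add: numeral_2_eq_2)
  have emitted: "comp_on UNIV 1 (\<lambda>p xs. emitted (?t p) (xs ! 0))"
  proof -
    let ?g = "\<lambda>p zs. if ?t p (zs ! 0) (zs ! 1) = 0 then zs ! 1 else Suc (zs ! 1)"
    have "comp_on UNIV 1 (\<lambda>p xs. rec_nat 0 (\<lambda>n y. ?g p (n # y # xs)) (xs ! 0))"
      by (rule comp_on_rec[where g = ?g]) (intro comp_on_if0 comp_on_intros A; simp)+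
    moreover have "rec_nat 0 (\<lambda>n y. ?g p (n # y # xs)) m = emitted (?t p) m" for p xs m
      by (induction m) auto
    ultimately show ?thesis by simp
  qed
  have "comp_on UNIV 1 (\<lambda>p xs. emit (?t p) (xs ! 0))"
    unfolding emit_def by (intro A emitted comp_on_nth) simp
  then have "computable_fun (\<lambda>p. Some (emit (?t p)))"
    by (rule computable_totalI)
  moreover have "minus_one (emit (?t p)) = Some q" if "F p = Some q" for p q
    by (rule minus_one_emit) (use approx_computes[OF e[OF that]] in blast)+
  ultimately show ?thesis by (intro exI[of _ "\<lambda>p. emit (?t p)"]) blast
qed

section \<open>Continuous functions\<close>

lemma continuous_funI:
  assumes "\<And>p q n. F p = Some q \<Longrightarrow>
    \<exists>k. \<forall>p' q'. F p' = Some q' \<longrightarrow> (\<forall>i<k. p' i = p i) \<longrightarrow> q' n = q n"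
  shows "continuous_fun F"
  unfolding continuous_fun_def
proof (rule continuous_on_coordinatewise_then_product, unfold continuous_on_topological, intro ballI allI impI)
  fix n p B assume "p \<in> dom F" "open B" and B: "the (F p) n \<in> B"
  then obtain q where q: "F p = Some q" by blast
  from assms[OF q] obtain k where
    k: "\<And>p' q'. F p' = Some q' \<Longrightarrow> (\<forall>i<k. p' i = p i) \<Longrightarrow> q' n = q n" by blast
  have "open {p'. \<forall>i\<in>{..<k}. p' (id i) \<in> {p i}}"
    by (rule product_topology_basis') (simp_all add: open_discrete)
  moreover have "\<forall>p'\<in>dom F. p' \<in> {p'. \<forall>i\<in>{..<k}. p' (id i) \<in> {p i}} \<longrightarrow> the (F p') n \<in> B"
  proof (intro ballI impI)
    fix p' assume "p' \<in> dom F" "p' \<in> {p'. \<forall>i\<in>{..<k}. p' (id i) \<in> {p i}}"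
    then obtain q' where "F p' = Some q'" "\<forall>i<k. p' i = p i" by auto
    with k have "the (F p') n = the (F p) n" using q by simp
    with B show "the (F p') n \<in> B" by simp
  qed
  ultimately show "\<exists>A. open A \<and> p \<in> A \<and> (\<forall>p'\<in>dom F. p' \<in> A \<longrightarrow> the (F p') n \<in> B)"
    by (intro exI[of _ "{p'. \<forall>i\<in>{..<k}. p' (id i) \<in> {p i}}"]) simp
qed

lemma continuous_funD:
  assumes "continuous_fun F" "F p = Some q"
  shows "\<exists>k. \<forall>p' q'. F p' = Some q' \<longrightarrow> (\<forall>i<k. p' i = p i) \<longrightarrow> q' n = q n"
proof -
  have "continuous_on (dom F) (\<lambda>p. the (F p) n)"
    using assms(1) unfolding continuous_fun_def by (rule continuous_on_product_then_coordinatewise)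
  moreover have "p \<in> dom F" "open {q n}" "the (F p) n \<in> {q n}"
    using assms(2) by (auto simp: open_discrete)
  ultimately obtain A where A: "open A" "p \<in> A" "\<forall>p'\<in>dom F. p' \<in> A \<longrightarrow> the (F p') n \<in> {q n}"
    unfolding continuous_on_topological by meson
  from A(1) have "openin (product_topology (\<lambda>i. euclidean) UNIV) A"
    by (simp add: open_fun_def)
  from product_topology_open_contains_basis[OF this A(2)] obtain X where
    X: "p \<in> (\<Pi>\<^sub>E i\<in>UNIV. X i)" "finite {i. X i \<noteq> UNIV}" "(\<Pi>\<^sub>E i\<in>UNIV. X i) \<subseteq> A"
    by auto
  from X(2) obtain k where k: "\<And>i. X i \<noteq> UNIV \<Longrightarrow> i < k"
    by (auto simp: finite_nat_set_iff_bounded)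
  have "q' n = q n" if "F p' = Some q'" "\<forall>i<k. p' i = p i" for p' q'
  proof -
    have "p' i \<in> X i" for i using X(1) k[of i] that(2) by (cases "X i = UNIV") (auto simp: PiE_iff)
    then have "p' \<in> A" using X(3) by (auto simp: PiE_iff)
    with A(3) that(1) show ?thesis by fastforce
  qed
  then show ?thesis by blast
qed

text \<open>A terminating computation asks its oracle finitely many questions. Phrasing this with
  \<open>eventually\<close> combines the bounds of subcomputations without computing maxima.\<close>

lemma computes_use:
  assumes "computes p e xs y"
  shows "\<forall>\<^sub>F k in sequentially. \<forall>p'. (\<forall>i<k. p' i = p i) \<longrightarrow> computes p' e xs y"
  using assms
proof (induction e xs y rule: computes.induct)
  case (Zero xs)
  show ?case by (simp add: computes.Zero)
next
  case (Succ x)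
  show ?case by (simp add: computes.Succ)
next
  case (Query x)
  show ?case using eventually_gt_at_top[of x]
    by eventually_elim (metis computes.Query)
next
  case (Proj i xs)
  then show ?case by (simp add: computes.Proj)
next
  case (Comp xs gs ys f z)
  have "\<forall>\<^sub>F k in sequentially. \<forall>i\<in>{..<length gs}. \<forall>p'. (\<forall>j<k. p' j = p j) \<longrightarrow> computes p' (gs ! i) xs (ys ! i)"
    using Comp.IH(1) by (intro eventually_ball_finite) (auto simp: list_all2_conv_all_nth)
  with Comp.IH(2) show ?case
  proof eventually_elim
    case (elim k)
    show ?case
    proof (intro allI impI)
      fix p' :: baire assume "\<forall>i<k. p' i = p i"
      with elim list_all2_lengthD[OF Comp.IH(1)] show "computes p' (Comp f gs) xs z"
        by (intro computes.Comp[where ys = ys]) (auto simp: list_all2_conv_all_nth)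
    qed
  qed
next
  case (PrimRec_0 f xs z g)
  from PrimRec_0.IH show ?case
    by eventually_elim (blast intro: computes.PrimRec_0)
next
  case (PrimRec_Suc f g n xs y z)
  from PrimRec_Suc.IH show ?case
    by eventually_elim (blast intro: computes.PrimRec_Suc)
next
  case (Mu f n xs)
  have "\<forall>\<^sub>F k in sequentially. \<forall>m\<in>{..<n}. \<exists>y. \<forall>p'. (\<forall>i<k. p' i = p i) \<longrightarrow> computes p' f (m # xs) (Suc y)"
  proof (intro eventually_ball_finite ballI finite_lessThan)
    fix m assume "m \<in> {..<n}"
    with Mu.IH(2) obtain y
      where "\<forall>\<^sub>F k in sequentially. \<forall>p'. (\<forall>i<k. p' i = p i) \<longrightarrow> computes p' f (m # xs) (Suc y)"
      by blast
    then show "\<forall>\<^sub>F k in sequentially. \<exists>y. \<forall>p'. (\<forall>i<k. p' i = p i) \<longrightarrow> computes p' f (m # xs) (Suc y)"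
      by eventually_elim blast
  qed
  with Mu.IH(1) show ?case
    by eventually_elim (blast intro: computes.Mu)
qed

lemma continuous_fun_of_computable:
  assumes "computable_fun F"
  shows "continuous_fun F"
proof (rule continuous_funI)
  fix p q n assume Fp: "F p = Some q"
  obtain e where e: "\<And>p q n. F p = Some q \<Longrightarrow> computes p e [n] (q n)"
    using computable_funE[OF assms] by blast
  obtain k where k: "\<And>p'. \<forall>i<k. p' i = p i \<Longrightarrow> computes p' e [n] (q n)"
    using computes_use[OF e[OF Fp, of n]] unfolding eventually_sequentially by blast
  show "\<exists>k. \<forall>p' q'. F p' = Some q' \<longrightarrow> (\<forall>i<k. p' i = p i) \<longrightarrow> q' n = q n"
  proof (intro exI[of _ k] allI impI)
    fix p' q' assume "F p' = Some q'" "\<forall>i<k. p' i = p i"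
    then show "q' n = q n" by (intro computes_deterministic[OF e k])
  qed
qed

lemma continuous_fun_comp:
  assumes "continuous_fun F" "continuous_fun G"
  shows "continuous_fun (F \<circ>\<^sub>m G)"
proof -
  let ?g = "\<lambda>p. the (G p)" and ?f = "\<lambda>p. the (F p)" and ?D = "dom (F \<circ>\<^sub>m G)"
  have "?D \<subseteq> dom G" "?g ` ?D \<subseteq> dom F"
    by (auto simp: map_comp_def split: option.splits)
  then have "continuous_on ?D ?g" "continuous_on (?g ` ?D) ?f"
    using assms unfolding continuous_fun_def by (metis continuous_on_subset)+
  then have "continuous_on ?D (?f \<circ> ?g)"
    by (rule continuous_on_compose)
  then show ?thesis unfolding continuous_fun_def
    by (rule continuous_on_eq) (auto simp: map_comp_def split: option.splits)
qed

text \<open>Continuity into a product can be tested one coordinate at a time, so each output entry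
  may be read off a continuous function of its own. Pairing and componentwise application then need
  no explicit modulus.\<close>

lemma continuous_fun_coordinatewise:
  assumes "\<And>m. \<exists>G j. continuous_fun G \<and> (\<forall>p q. F p = Some q \<longrightarrow> (\<exists>r. G p = Some r \<and> r j = q m))"
  shows "continuous_fun F"
proof (rule continuous_funI)
  fix p q n assume Fp: "F p = Some q"
  from assms[of n] obtain G j where G: "continuous_fun G"
    "\<And>p q. F p = Some q \<Longrightarrow> \<exists>r. G p = Some r \<and> r j = q n" by blast
  from G(2)[OF Fp] obtain r where r: "G p = Some r" "r j = q n" by blast
  from continuous_funD[OF G(1) r(1), of j] G(2) r(2)
  show "\<exists>k. \<forall>p' q'. F p' = Some q' \<longrightarrow> (\<forall>i<k. p' i = p i) \<longrightarrow> q' n = q n"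
    by metis
qed

lemma continuous_fun_pair:
  assumes "continuous_fun F" "continuous_fun G"
  shows "continuous_fun (fun_pair F G)"
proof (rule continuous_fun_coordinatewise)
  fix m
  show "\<exists>G' j. continuous_fun G' \<and> (\<forall>p q. fun_pair F G p = Some q \<longrightarrow> (\<exists>r. G' p = Some r \<and> r j = q m))"
  proof (cases "even m")
    case True
    then show ?thesis using assms(1)
      by (intro exI[of _ F] exI[of _ "m div 2"]) (auto simp: fun_pair_eq_Some_iff baire_pair_def)
  next
    case False
    then show ?thesis using assms(2)
      by (intro exI[of _ G] exI[of _ "m div 2"]) (auto simp: fun_pair_eq_Some_iff baire_pair_def)
  qed
qed

lemma computable_component: "computable_fun (\<lambda>p. Some (component p n))"
  unfolding component_def
proof (rule computable_totalI)
  show "comp_on UNIV 1 (\<lambda>p xs. p (cantor_pair n (xs ! 0)))"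
    by (intro comp_on_intros; simp)
qed

lemma continuous_fun_map_components:
  assumes "continuous_fun F"
  shows "continuous_fun (map_components F)"
proof (rule continuous_fun_coordinatewise)
  fix m
  show "\<exists>G j. continuous_fun G \<and> (\<forall>p q. map_components F p = Some q \<longrightarrow> (\<exists>r. G p = Some r \<and> r j = q m))"
  proof (intro exI conjI)
    show "continuous_fun (F \<circ>\<^sub>m (\<lambda>p. Some (component p (block m))))"
      by (intro continuous_fun_comp assms continuous_fun_of_computable computable_component)
    show "\<forall>p q. map_components F p = Some q \<longrightarrow>
      (\<exists>r. (F \<circ>\<^sub>m (\<lambda>p. Some (component p (block m)))) p = Some r \<and> r (offset m) = q m)"
      by (simp add: map_components_eq_Some_iff) (simp add: component_def)
  qed
qed

lemma continuous_fun_lift: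
  assumes "continuous_fun F"
  shows "\<exists>L. continuous_fun (\<lambda>p. Some (L p)) \<and> (\<forall>p q. F p = Some q \<longrightarrow> minus_one (L p) = Some q)"
proof -
  \<comment> \<open>\<open>A p s n\<close> holds the values that entry \<open>n\<close> can still
    take given the first \<open>s\<close> entries of \<open>p\<close>. It makes sense for every
    \<open>p\<close>, which makes the lift total; an entry counts as known once this set is a
    singleton, and the empty set, for a prefix without extension in the domain, counts as no
    knowledge.\<close>
  define A where "A p s n = {q n |p' q. F p' = Some q \<and> (\<forall>i<s. p' i = p i)}" for p :: baire and s n :: nat
  define t where "t p s n = (if \<exists>y. A p s n = {y} then Suc (the_elem (A p s n)) else 0)" for p s n
  have t_cong: "t p' s = t p s" if "\<forall>i<s. p' i = p i" for p p' s
  proof -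
    have "(\<forall>i<s. r i = p' i) \<longleftrightarrow> (\<forall>i<s. r i = p i)" for r using that by auto
    then have "A p' s n = A p s n" for n by (simp only: A_def)
    then show ?thesis by (simp only: t_def fun_eq_iff simp_thms)
  qed
  have emitted_cong: "emitted (t p') s = emitted (t p) s" if "\<forall>i<s. p' i = p i" for p p' s
    using that
  proof (induction s)
    case (Suc s)
    then show ?case using t_cong[of s p' p] by simp
  qed simp
  \<comment> \<open>Stage \<open>n\<close> inspects only the first \<open>n\<close> entries of
    \<open>p\<close>, so output entry \<open>n\<close> has modulus \<open>n\<close>.\<close>
  have "continuous_fun (\<lambda>p. Some (emit (t p)))"
  proof (rule continuous_funI)
    fix p q n assume "Some (emit (t p)) = Some q"
    moreover have "emit (t p') n = emit (t p) n" if "\<forall>i<n. p' i = p i" for p'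
      by (simp only: emit_def t_cong[OF that] emitted_cong[OF that])
    ultimately show "\<exists>k. \<forall>p' q'. Some (emit (t p')) = Some q' \<longrightarrow> (\<forall>i<k. p' i = p i) \<longrightarrow> q' n = q n"
      by (intro exI[of _ n]) auto
  qed
  moreover have "minus_one (emit (t p)) = Some q" if q: "F p = Some q" for p q
  proof (rule minus_one_emit)
    have mem: "q n \<in> A p s n" for s n using q unfolding A_def by blast
    then show "t p s n = 0 \<or> t p s n = Suc (q n)" for s n
      unfolding t_def by force
    fix n
    obtain k where k: "\<And>p' q'. F p' = Some q' \<Longrightarrow> \<forall>i<k. p' i = p i \<Longrightarrow> q' n = q n"
      using continuous_funD[OF assms q] by metis
    show "\<forall>\<^sub>F s in sequentially. t p s n = Suc (q n)"
      using eventually_ge_at_top[of k]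
    proof eventually_elim
      case (elim s)
      have "A p s n \<subseteq> {q n}"
      proof
        fix y assume "y \<in> A p s n"
        then obtain p' q' where y: "y = q' n" and q': "F p' = Some q'" and "\<forall>i<s. p' i = p i"
          unfolding A_def by blast
        with elim have "\<forall>i<k. p' i = p i" by simp
        with k[OF q'] y show "y \<in> {q n}" by simp
      qed
      then have "A p s n = {q n}" using mem[of n s] by blast
      then show ?case by (simp add: t_def)
    qed
  qed
  ultimately show ?thesis by (intro exI[of _ "\<lambda>p. emit (t p)"]) blast
qed

section \<open>Problems in terms of names\<close>

text \<open>Reductions act on names. From here on a problem matters only through the relation
  between names of its instances and names of their solutions; points are used just to find out how
  \<open>\<Pi>\<close> and \<open>\<Sigma>\<close> act on this relation.\<close>

definition instance_name :: "('a, 'b) problem \<Rightarrow> baire \<Rightarrow> bool" where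
  "instance_name f p \<longleftrightarrow> (\<exists>x. in_rep f p = Some x \<and> x \<in> pdom f)"

definition solution_name :: "('a, 'b) problem \<Rightarrow> baire \<Rightarrow> baire \<Rightarrow> bool" where
  "solution_name f p q \<longleftrightarrow> (\<exists>x y. in_rep f p = Some x \<and> out_rep f q = Some y \<and> y \<in> sol f x)"

definition solvable :: "('a, 'b) problem \<Rightarrow> bool" where
  "solvable f \<longleftrightarrow> (\<forall>p. instance_name f p \<longrightarrow> (\<exists>q. solution_name f p q))"

lemma realizer_iff_names:
  "realizer f F \<longleftrightarrow> (\<forall>p. instance_name f p \<longrightarrow> (\<exists>q. F p = Some q \<and> solution_name f p q))"
proof (intro iffI allI impI)
  fix p assume "realizer f F" "instance_name f p"
  then obtain x y where "in_rep f p = Some x" "(out_rep f \<circ>\<^sub>m F) p = Some y" "y \<in> sol f x"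
    unfolding realizer_def instance_name_def by blast
  then show "\<exists>q. F p = Some q \<and> solution_name f p q"
    by (auto simp: map_comp_Some_iff solution_name_def)
next
  assume names: "\<forall>p. instance_name f p \<longrightarrow> (\<exists>q. F p = Some q \<and> solution_name f p q)"
  show "realizer f F"
    unfolding realizer_def
  proof (intro allI impI)
    fix p x assume x: "in_rep f p = Some x \<and> x \<in> pdom f"
    then have "instance_name f p" unfolding instance_name_def by blast
    with names obtain q where "F p = Some q" "solution_name f p q" by blast
    with x show "\<exists>y. (out_rep f \<circ>\<^sub>m F) p = Some y \<and> y \<in> sol f x"
      by (auto simp: map_comp_Some_iff solution_name_def)
  qed
qed

lemma solvable_iff_realizer: "solvable f \<longleftrightarrow> (\<exists>F. realizer f F)"
proof
  assume "solvable f"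
  then have "realizer f (\<lambda>p. Some (SOME q. solution_name f p q))"
    unfolding realizer_iff_names solvable_def by (metis someI_ex)
  then show "\<exists>F. realizer f F" by blast
qed (auto simp: solvable_def realizer_iff_names)

lemma minus_one_Suc: "minus_one (\<lambda>k. Suc (q k)) = Some q"
proof -
  have "enumerate (UNIV :: nat set) k = k" for k
    using card_enumerate_lessThan[of UNIV k] by simp
  then show ?thesis by (simp add: minus_one_def)
qed

lemma instance_name_parallelization [simp]:
  fixes f :: "('a, 'b) problem"
  shows "instance_name (\<Pi> f) p \<longleftrightarrow> (\<forall>n. instance_name f (component p n))"
proof -
  have "pdom (\<Pi> f) = {x. \<forall>n. x n \<in> pdom f}"
  proof (intro equalityI subsetI)
    fix x :: "nat \<Rightarrow> 'a" assume "x \<in> {x. \<forall>n. x n \<in> pdom f}"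
    then have x: "\<forall>n. x n \<in> pdom f" by simp
    then have "\<forall>n. \<exists>y. y \<in> sol f (x n)" unfolding pdom_def by blast
    then obtain y where "\<forall>n. y n \<in> sol f (x n)" by (rule choice[THEN exE])
    with x have "y \<in> sol (\<Pi> f) x" by (simp add: parallelization_def)
    then show "x \<in> pdom (\<Pi> f)" unfolding pdom_def[of "\<Pi> f"] by blast
  next
    fix x assume "x \<in> pdom (\<Pi> f)"
    then have "sol (\<Pi> f) x \<noteq> {}" by (simp add: pdom_def)
    then show "x \<in> {x. \<forall>n. x n \<in> pdom f}"
      by (simp add: parallelization_def split: if_splits)
  qed
  moreover have "in_rep (\<Pi> f) p = Some x \<longleftrightarrow> (\<forall>n. in_rep f (component p n) = Some (x n))" for x
    by (simp add: parallelization_def seq_rep_eq_Some_iff)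
  ultimately have "instance_name (\<Pi> f) p \<longleftrightarrow>
      (\<exists>x. \<forall>n. in_rep f (component p n) = Some (x n) \<and> x n \<in> pdom f)"
    unfolding instance_name_def by auto
  then show ?thesis
    unfolding instance_name_def choice_iff .
qed

lemma solution_name_parallelization [simp]:
  "solution_name (\<Pi> f) p q \<longleftrightarrow> (\<forall>n. solution_name f (component p n) (component q n))"
proof
  assume "solution_name (\<Pi> f) p q"
  then obtain x y where "in_rep (\<Pi> f) p = Some x" "out_rep (\<Pi> f) q = Some y" "y \<in> sol (\<Pi> f) x"
    unfolding solution_name_def by blast
  then have "\<forall>n. in_rep f (component p n) = Some (x n)" "\<forall>n. out_rep f (component q n) = Some (y n)"
    "\<forall>n. y n \<in> sol f (x n)"
    by (auto simp: parallelization_def seq_rep_eq_Some_iff split: if_splits)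
  then show "\<forall>n. solution_name f (component p n) (component q n)"
    unfolding solution_name_def by blast
next
  assume "\<forall>n. solution_name f (component p n) (component q n)"
  then obtain x y where xy: "\<And>n. in_rep f (component p n) = Some (x n)"
    "\<And>n. out_rep f (component q n) = Some (y n)" "\<And>n. y n \<in> sol f (x n)"
    unfolding solution_name_def by metis
  then have "\<forall>n. x n \<in> pdom f" by (auto simp: pdom_def)
  with xy show "solution_name (\<Pi> f) p q"
    unfolding solution_name_def
    by (intro exI[of _ x] exI[of _ y]) (simp add: parallelization_def seq_rep_eq_Some_iff)
qed

lemma completion_rep_eq_Some_iff:
  "completion_rep \<delta> p = Some (Some v) \<longleftrightarrow> (\<exists>r. minus_one p = Some r \<and> \<delta> r = Some v)"
  by (simp add: completion_rep_def map_comp_Some_iff)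

lemma instance_name_stashing [simp]:
  assumes "solvable f"
  shows "instance_name (\<Sigma> f) p \<longleftrightarrow> (\<forall>n. instance_name f (component p n))"
proof
  assume "instance_name (\<Sigma> f) p"
  then obtain x where "in_rep (\<Sigma> f) p = Some x" "sol (\<Sigma> f) x \<noteq> {}"
    unfolding instance_name_def pdom_def by blast
  then have "\<forall>n. in_rep f (component p n) = Some (x n)" "\<forall>n. x n \<in> pdom f"
    by (auto simp: stashing_def seq_rep_eq_Some_iff split: if_splits)
  then show "\<forall>n. instance_name f (component p n)"
    unfolding instance_name_def by blast
next
  assume inst: "\<forall>n. instance_name f (component p n)"
  then obtain x where x: "\<And>n. in_rep f (component p n) = Some (x n)" "\<And>n. x n \<in> pdom f"
    unfolding instance_name_def by metis
  from inst assms obtain q where "solution_name f (component p 0) q"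
    unfolding solvable_def by blast
  then obtain v where v: "out_rep f q = Some v" "v \<in> sol f (x 0)"
    unfolding solution_name_def using x(1)[of 0] by auto
  have "completion_rep (out_rep f) (\<lambda>k. Suc (q k)) = Some (Some v)"
    using v(1) by (simp add: completion_rep_eq_Some_iff minus_one_Suc)
  then have "Some v \<in> ran (completion_rep (out_rep f))" by (auto simp: ran_def)
  \<comment> \<open>One correct position suffices for a stash, so an answer for position 0 may be
    repeated everywhere.\<close>
  then have "(\<lambda>_. Some v) \<in> sol (\<Sigma> f) x"
    using x(2) v(2) by (auto simp: stashing_def)
  then have "x \<in> pdom (\<Sigma> f)" unfolding pdom_def by blast
  moreover have "in_rep (\<Sigma> f) p = Some x"
    using x(1) by (simp add: stashing_def seq_rep_eq_Some_iff)
  ultimately show "instance_name (\<Sigma> f) p" unfolding instance_name_def by blast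
qed

lemma solution_name_stashing [simp]:
  "solution_name (\<Sigma> f) p q \<longleftrightarrow> (\<forall>n. instance_name f (component p n)) \<and>
    (\<exists>n r. minus_one (component q n) = Some r \<and> solution_name f (component p n) r)"
proof
  assume "solution_name (\<Sigma> f) p q"
  then obtain x y where x: "\<And>n. in_rep f (component p n) = Some (x n)" "\<And>n. x n \<in> pdom f"
    and y: "\<And>n. completion_rep (out_rep f) (component q n) = Some (y n)" "\<exists>n. y n \<in> Some ` sol f (x n)"
    unfolding solution_name_def by (auto simp: stashing_def seq_rep_eq_Some_iff split: if_splits)
  from y(2) obtain n v where v: "y n = Some v" "v \<in> sol f (x n)" by blast
  with y(1)[of n] x(1)[of n] have "\<exists>r. minus_one (component q n) = Some r \<and> solution_name f (component p n) r"
    by (auto simp: completion_rep_eq_Some_iff solution_name_def)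
  with x show "(\<forall>n. instance_name f (component p n)) \<and>
    (\<exists>n r. minus_one (component q n) = Some r \<and> solution_name f (component p n) r)"
    unfolding instance_name_def by blast
next
  assume asm: "(\<forall>n. instance_name f (component p n)) \<and>
    (\<exists>n r. minus_one (component q n) = Some r \<and> solution_name f (component p n) r)"
  then obtain x where x: "\<And>n. in_rep f (component p n) = Some (x n)" "\<And>n. x n \<in> pdom f"
    unfolding instance_name_def by metis
  define y where "y n = (out_rep f \<circ>\<^sub>m minus_one) (component q n)" for n
  have y: "completion_rep (out_rep f) (component q n) = Some (y n)" for n
    by (simp add: completion_rep_def y_def)
  from asm obtain n r where r: "minus_one (component q n) = Some r" "solution_name f (component p n) r"
    by blast
  then have "y n \<in> Some ` sol f (x n)"
    using x(1)[of n] by (auto simp: solution_name_def y_def)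
  then have "y \<in> sol (\<Sigma> f) x"
    using x(2) y by (auto simp: stashing_def ran_def)
  with x(1) y show "solution_name (\<Sigma> f) p q"
    unfolding solution_name_def by (intro exI[of _ x] exI[of _ y]) (simp add: stashing_def seq_rep_eq_Some_iff)
qed

lemma solvable_parallelization [simp]:
  assumes "solvable f" shows "solvable (\<Pi> f)"
  unfolding solvable_def
proof (intro allI impI)
  fix p assume "instance_name (\<Pi> f) p"
  then have "\<forall>n. \<exists>q. solution_name f (component p n) q"
    using assms unfolding solvable_def by simp
  then obtain q where "\<forall>n. solution_name f (component p n) (q n)"
    by (rule choice[THEN exE])
  then show "\<exists>q. solution_name (\<Pi> f) p q"
    by (intro exI[of _ "baire_tuple q"]) simp
qed

lemma solvable_stashing [simp]:
  assumes "solvable f" shows "solvable (\<Sigma> f)"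
  unfolding solvable_def
proof (intro allI impI)
  fix p assume "instance_name (\<Sigma> f) p"
  then have inst: "\<forall>n. instance_name f (component p n)" using assms by simp
  then obtain q where "solution_name f (component p 0) q"
    using assms unfolding solvable_def by blast
  with inst show "\<exists>q. solution_name (\<Sigma> f) p q"
    by (intro exI[of _ "baire_tuple (\<lambda>n k. Suc (q k))"]) (auto simp: minus_one_Suc)
qed

section \<open>Reducibilities\<close>

text \<open>\<open>h p q\<close> is what \<open>H\<close> sees of the original name \<open>p\<close>
  and the answer \<open>q\<close>: the answer alone for strong reductions, the pair
  otherwise.\<close>

definition red ::
    "((baire \<rightharpoonup> baire) \<Rightarrow> bool) \<Rightarrow> (baire \<Rightarrow> baire \<Rightarrow> baire) \<Rightarrow> ('a, 'b) problem \<Rightarrow> ('c, 'd) problem \<Rightarrow> bool" where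
  "red \<C> h f g \<longleftrightarrow> (\<exists>H K. \<C> H \<and> \<C> K \<and>
     (\<forall>G. realizer g G \<longrightarrow> realizer f (H \<circ>\<^sub>m (\<lambda>p. map_option (h p) ((G \<circ>\<^sub>m K) p)))))"

lemma strong_reducible_eq_red: "strong_reducible \<C> = red \<C> (\<lambda>p q. q)"
  unfolding strong_reducible_def red_def fun_eq_iff by (simp add: option.map_ident)

lemma reducible_eq_red: "reducible \<C> = red \<C> baire_pair"
  unfolding reducible_def red_def fun_eq_iff by simp

text \<open>The pointwise content of a reduction. With no realizers quantified over, witnesses can
  be composed and applied to single components directly.\<close>

definition names_red ::
    "(baire \<Rightarrow> baire \<Rightarrow> baire) \<Rightarrow> ('a, 'b) problem \<Rightarrow> ('c, 'd) problem \<Rightarrow>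
      (baire \<rightharpoonup> baire) \<Rightarrow> (baire \<rightharpoonup> baire) \<Rightarrow> bool" where
  "names_red h f g H K \<longleftrightarrow> (\<forall>p. instance_name f p \<longrightarrow> (\<exists>p'. K p = Some p' \<and> instance_name g p' \<and>
     (\<forall>q. solution_name g p' q \<longrightarrow> (\<exists>q'. H (h p q) = Some q' \<and> solution_name f p q'))))"

lemma redI:
  assumes "\<C> H" "\<C> K" "names_red h f g H K"
  shows "red \<C> h f g"
  unfolding red_def
proof (rule exI[of _ H], rule exI[of _ K], intro conjI allI impI assms(1,2))
  fix G assume G: "realizer g G"
  show "realizer f (H \<circ>\<^sub>m (\<lambda>p. map_option (h p) ((G \<circ>\<^sub>m K) p)))"
    unfolding realizer_iff_names
  proof (intro allI impI)
    fix p assume "instance_name f p"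
    with assms(3) obtain p' where p': "K p = Some p'" "instance_name g p'"
      and H: "\<And>q. solution_name g p' q \<Longrightarrow> \<exists>q'. H (h p q) = Some q' \<and> solution_name f p q'"
      unfolding names_red_def by blast
    from G p'(2) obtain q where q: "G p' = Some q" "solution_name g p' q"
      unfolding realizer_iff_names by blast
    from H[OF q(2)] p'(1) q(1)
    show "\<exists>q. (H \<circ>\<^sub>m (\<lambda>p. map_option (h p) ((G \<circ>\<^sub>m K) p))) p = Some q \<and> solution_name f p q"
      by (simp add: map_comp_def)
  qed
qed

lemma redE:
  assumes "red \<C> h f g" "solvable g"
  obtains H K where "\<C> H" "\<C> K" "names_red h f g H K"
proof -
  from assms(1) obtain H K where HK: "\<C> H" "\<C> K"
    and real: "\<And>G. realizer g G \<Longrightarrow> realizer f (H \<circ>\<^sub>m (\<lambda>p. map_option (h p) ((G \<circ>\<^sub>m K) p)))"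
    unfolding red_def by blast
  have "names_red h f g H K"
    unfolding names_red_def
  proof (intro allI impI)
    fix p assume p: "instance_name f p"
    \<comment> \<open>A realizer of \<open>g\<close> may be undefined off the names of instances and may return any prescribed
      name of a solution.\<close>
    define G where "G q' r = (if instance_name g r then
      Some (if solution_name g r q' then q' else SOME q. solution_name g r q) else None)" for q' r
    have "solution_name g r (SOME q. solution_name g r q)" if "instance_name g r" for r
    proof -
      have "\<exists>q. solution_name g r q" using assms(2) that unfolding solvable_def by blast
      then show ?thesis by (rule someI_ex)
    qed
    then have "realizer g (G q')" for q'
      unfolding realizer_iff_names by (simp add: G_def)
    from real[OF this] p have out: "\<exists>q. (H \<circ>\<^sub>m (\<lambda>p. map_option (h p) ((G q' \<circ>\<^sub>m K) p))) p = Some q \<and> solution_name f p q"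
      for q' unfolding realizer_iff_names by blast
    from out[of undefined] obtain p' where Kp: "K p = Some p'" "G undefined p' \<noteq> None"
      by (auto simp: map_comp_def split: option.splits)
    then have p': "K p = Some p'" "instance_name g p'"
      by (auto simp: G_def split: if_splits)
    moreover have "\<exists>r. H (h p q) = Some r \<and> solution_name f p r" if "solution_name g p' q" for q
      using out[of q] p' that by (simp add: map_comp_def G_def)
    ultimately show "\<exists>p'. K p = Some p' \<and> instance_name g p' \<and>
      (\<forall>q. solution_name g p' q \<longrightarrow> (\<exists>q'. H (h p q) = Some q' \<and> solution_name f p q'))" by blast
  qed
  with HK that show thesis by blast
qed

section \<open>Computable rearrangements of names\<close>

lemma computable_fun_Some: "computable_fun Some"
  unfolding computable_fun_def by (auto intro!: exI[of _ Query] computes.Query)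

text \<open>Doubling is written as a sum so that computability follows from
  \<open>comp_on_add\<close>.\<close>

definition even_part :: "baire \<Rightarrow> baire" where "even_part r = (\<lambda>n. r (n + n))"
definition odd_part :: "baire \<Rightarrow> baire" where "odd_part r = (\<lambda>n. r (Suc (n + n)))"

lemma even_part_pair [simp]: "even_part (baire_pair p q) = p"
  by (simp add: even_part_def baire_pair_def flip: mult_2)

lemma odd_part_pair [simp]: "odd_part (baire_pair p q) = q"
  by (simp add: odd_part_def baire_pair_def flip: mult_2)

lemma computable_even_part: "computable_fun (\<lambda>r. Some (even_part r))"
  unfolding even_part_def
proof (rule computable_totalI)
  show "comp_on UNIV 1 (\<lambda>r xs. r (xs ! 0 + xs ! 0))"
    by (intro comp_on_intros; simp)
qed

lemma computable_odd_part: "computable_fun (\<lambda>r. Some (odd_part r))"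
  unfolding odd_part_def
proof (rule computable_totalI)
  show "comp_on UNIV 1 (\<lambda>r xs. r (Suc (xs ! 0 + xs ! 0)))"
    by (intro comp_on_intros; simp)
qed

definition unflatten :: "baire \<Rightarrow> baire" where
  "unflatten q m = q (cantor_pair (cantor_pair (block m) (block (offset m))) (offset (offset m)))"

lemma component_unflatten [simp]:
  "component (component (unflatten q) i) j = component q (cantor_pair i j)"
  by (simp add: component_def unflatten_def)

lemma computable_unflatten: "computable_fun (\<lambda>q. Some (unflatten q))"
  by (rule computable_totalI) (unfold unflatten_def, intro comp_on_intros; simp)

definition flatten :: "baire \<Rightarrow> baire" where
  "flatten q m = q (cantor_pair (block (block m)) (cantor_pair (offset (block m)) (offset m)))"

lemma component_flatten [simp]:
  "component (flatten q) n = component (component q (block n)) (offset n)"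
  by (simp add: component_def flatten_def)

lemma computable_flatten: "computable_fun (\<lambda>q. Some (flatten q))"
  by (rule computable_totalI) (unfold flatten_def, intro comp_on_intros; simp)

text \<open>
  Component \<open>\<sigma> m\<close> of the input is only the name of a point of a completion, so decoding it may diverge;
  the lift makes every component of the output total nevertheless.
\<close>

lemma computable_lift_components:
  assumes P: "computable_fun P"
    and \<sigma>: "comp_on UNIV 1 (\<lambda>p xs. \<sigma> (block (xs ! 0)))"
    and \<phi>: "comp_on UNIV 1 (\<lambda>p xs. \<phi> (p 0) (xs ! 0))"
  shows "\<exists>M. computable_fun (\<lambda>q. Some (M q)) \<and> (\<forall>q m r s.
    minus_one (component q (\<sigma> m)) = Some r \<longrightarrow> P (\<lambda>x. r (\<phi> m x)) = Some s \<longrightarrow>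
    minus_one (component (M q) m) = Some s)"
proof -
  \<comment> \<open>A single function must serve all output components, so each is told its index:
    \<open>?tag\<close> interleaves the constant sequence \<open>m\<close> with input component
    \<open>\<sigma> m\<close>. Once the odd half has been decoded, entry 0 still is
    \<open>m\<close>, and \<open>?sel\<close> reads the decoded name, found at the odd places, at
    the positions \<open>\<phi> m x\<close>.\<close>
  let ?sel = "\<lambda>r. Some (\<lambda>x. r (Suc (\<phi> (r 0) x + \<phi> (r 0) x)))"
  let ?F = "P \<circ>\<^sub>m (?sel \<circ>\<^sub>m
    fun_pair (\<lambda>r. Some (even_part r)) (minus_one \<circ>\<^sub>m (\<lambda>r. Some (odd_part r))))"
  let ?tag = "\<lambda>q m. if even (offset m) then block m
    else q (cantor_pair (\<sigma> (block m)) (offset m div 2))"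
  have sel: "computable_fun ?sel"
    by (rule computable_totalI) (intro comp_on_query comp_on_Suc comp_on_add \<phi>)
  have tag: "computable_fun (\<lambda>q. Some (?tag q))"
    by (rule computable_totalI)
      (intro comp_on_if_even comp_on_query comp_on_cantor_pair comp_on_half comp_on_offset
        comp_on_block comp_on_nth \<sigma>; simp)
  have "computable_fun ?F"
    by (intro computable_fun_comp computable_fun_pair P sel computable_even_part
      computable_odd_part computable_fun_minus_one)
  then obtain L where L: "computable_fun (\<lambda>p. Some (L p))"
    "\<And>p q. ?F p = Some q \<Longrightarrow> minus_one (L p) = Some q"
    using computable_fun_lift by blast
  define M where "M q = baire_tuple (\<lambda>m. L (component (?tag q) m))" for q
  have "map_components (\<lambda>p. Some (L p)) (?tag q) = Some (M q)" for q
    by (simp add: map_components_eq_Some_iff M_def)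
  then have "map_components (\<lambda>p. Some (L p)) \<circ>\<^sub>m (\<lambda>q. Some (?tag q)) = (\<lambda>q. Some (M q))"
    by (simp add: fun_eq_iff map_comp_def)
  then have "computable_fun (\<lambda>q. Some (M q))"
    using computable_fun_comp[OF computable_fun_map_components[OF L(1)] tag] by simp
  moreover have "minus_one (component (M q) m) = Some s"
    if r: "minus_one (component q (\<sigma> m)) = Some r" and s: "P (\<lambda>x. r (\<phi> m x)) = Some s" for q m r s
  proof -
    have tag_eq: "component (?tag q) m = baire_pair (\<lambda>_. m) (component q (\<sigma> m))"
      by (simp add: component_def baire_pair_def fun_eq_iff)
    have "?F (component (?tag q) m) = P (\<lambda>x. r (\<phi> m x))"
      unfolding tag_eq using r by (simp add: map_comp_def fun_pair_def) (simp add: baire_pair_def)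
    with s L(2) show ?thesis by (simp add: M_def)
  qed
  ultimately show ?thesis by blast
qed

text \<open>Two classes of functions and two choices of \<open>h\<close> yield the four
  reducibilities. Through \<open>computable\<close>, concrete rearrangements need to be checked for
  computability only.\<close>

locale reducibility =
  fixes \<C> :: "(baire \<rightharpoonup> baire) \<Rightarrow> bool" and h :: "baire \<Rightarrow> baire \<Rightarrow> baire"
  assumes computable: "computable_fun F \<Longrightarrow> \<C> F"
    and comp: "\<C> F \<Longrightarrow> \<C> G \<Longrightarrow> \<C> (F \<circ>\<^sub>m G)"
    and pair: "\<C> F \<Longrightarrow> \<C> G \<Longrightarrow> \<C> (fun_pair F G)"
    and components: "\<C> F \<Longrightarrow> \<C> (map_components F)"
    and lift: "\<C> F \<Longrightarrow> \<exists>L. \<C> (\<lambda>p. Some (L p)) \<and> (\<forall>p q. F p = Some q \<longrightarrow> minus_one (L p) = Some q)"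
    and h: "h = (\<lambda>p q. q) \<or> h = baire_pair"
begin

abbreviation le (infix "\<preceq>" 50) where "f \<preceq> g \<equiv> red \<C> h f g"

text \<open>This lemma and the next three are the only ones in the locale that distinguish the two
  choices of \<open>h\<close>.\<close>

lemma answer_of_h: "\<exists>V. \<C> V \<and> (\<forall>p q. V (h p q) = Some q)"
  using h
proof
  assume "h = (\<lambda>p q. q)"
  then show ?thesis using computable[OF computable_fun_Some] by blast
next
  assume "h = baire_pair"
  then show ?thesis using computable[OF computable_odd_part]
    by (intro exI[of _ "\<lambda>r. Some (odd_part r)"]) simp
qed

lemma components_of_h:
  "\<exists>Z. \<C> (\<lambda>r. Some (Z r)) \<and> (\<forall>p q n. component (Z (h p q)) n = h (component p n) (component q n))"
  using h
proof
  assume "h = (\<lambda>p q. q)"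
  then show ?thesis using computable[OF computable_fun_Some] by (intro exI[of _ "\<lambda>r. r"]) simp
next
  assume h: "h = baire_pair"
  \<comment> \<open>Entry \<open>k\<close> of component \<open>n\<close> of the result is entry
    \<open>k div 2\<close> of component \<open>n\<close> of \<open>p\<close> or of \<open>q\<close>,
    depending on the parity of \<open>k\<close>. In the given pair it stands at twice the index
    \<open>?c\<close>, or one place later.\<close>
  let ?c = "\<lambda>m. cantor_pair (block m) (offset m div 2)"
  let ?Z = "\<lambda>r m. if even (offset m) then r (?c m + ?c m) else r (Suc (?c m + ?c m))"
  have "computable_fun (\<lambda>r. Some (?Z r))"
    by (rule computable_totalI) (intro comp_on_intros; simp)
  moreover have "component (?Z (h p q)) n = h (component p n) (component q n)" for p q n
    by (simp add: h component_def baire_pair_def fun_eq_iff flip: mult_2)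
  ultimately show ?thesis using computable by (intro exI[of _ ?Z]) simp
qed

lemma minus_one_of_h:
  "\<exists>W. \<C> W \<and> (\<forall>p q r. minus_one q = Some r \<longrightarrow> W (h p q) = Some (h p r))"
  using h
proof
  assume "h = (\<lambda>p q. q)"
  then show ?thesis using computable[OF computable_fun_minus_one] by (intro exI[of _ minus_one]) simp
next
  assume h: "h = baire_pair"
  let ?W = "fun_pair (\<lambda>r. Some (even_part r)) (minus_one \<circ>\<^sub>m (\<lambda>r. Some (odd_part r)))"
  have "computable_fun ?W"
    by (intro computable_fun_pair computable_fun_comp computable_even_part
      computable_odd_part computable_fun_minus_one)
  with computable show ?thesis by (intro exI[of _ ?W]) (simp add: h fun_pair_def map_comp_def)
qed

lemma compose_h:
  assumes "\<C> H" "\<C> H'" "\<C> K"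
  shows "\<exists>H''. \<C> H'' \<and> (\<forall>p p' q a b. K p = Some p' \<longrightarrow> H' (h p' q) = Some a \<longrightarrow>
    H (h p a) = Some b \<longrightarrow> H'' (h p q) = Some b)"
  using h
proof
  assume "h = (\<lambda>p q. q)"
  then show ?thesis using assms comp by (intro exI[of _ "H \<circ>\<^sub>m H'"]) (simp add: map_comp_def)
next
  assume h: "h = baire_pair"
  let ?e = "\<lambda>r. Some (even_part r)" and ?o = "\<lambda>r. Some (odd_part r)"
  \<comment> \<open>\<open>H'\<close> expects the intermediate instance next to the answer; it is
    recomputed by \<open>K\<close> from the original name, which \<open>H\<close> then needs once
    more.\<close>
  let ?H = "H \<circ>\<^sub>m fun_pair ?e (H' \<circ>\<^sub>m fun_pair (K \<circ>\<^sub>m ?e) ?o)"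
  have "\<C> ?H"
    by (intro comp pair assms computable computable_even_part computable_odd_part)
  then show ?thesis by (intro exI[of _ ?H]) (simp add: h fun_pair_def map_comp_def)
qed

lemma le_trans:
  assumes "f \<preceq> g" "g \<preceq> k" "solvable g" "solvable k"
  shows "f \<preceq> k"
proof -
  obtain H K where HK: "\<C> H" "\<C> K" "names_red h f g H K"
    using redE[OF assms(1,3)] by blast
  obtain H' K' where HK': "\<C> H'" "\<C> K'" "names_red h g k H' K'"
    using redE[OF assms(2,4)] by blast
  obtain H'' where H'': "\<C> H''" "\<And>p p' q a b. K p = Some p' \<Longrightarrow> H' (h p' q) = Some a \<Longrightarrow>
      H (h p a) = Some b \<Longrightarrow> H'' (h p q) = Some b"
    using compose_h[OF HK(1) HK'(1) HK(2)] by blast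
  have "names_red h f k H'' (K' \<circ>\<^sub>m K)"
    unfolding names_red_def
  proof (intro allI impI)
    fix p assume "instance_name f p"
    with HK(3) obtain p' where p': "K p = Some p'" "instance_name g p'"
      and H: "\<And>q. solution_name g p' q \<Longrightarrow> \<exists>q'. H (h p q) = Some q' \<and> solution_name f p q'"
      unfolding names_red_def by blast
    from HK'(3) p'(2) obtain p'' where p'': "K' p' = Some p''" "instance_name k p''"
      and H': "\<And>q. solution_name k p'' q \<Longrightarrow> \<exists>q'. H' (h p' q) = Some q' \<and> solution_name g p' q'"
      unfolding names_red_def by blast
    have "\<exists>q'. H'' (h p q) = Some q' \<and> solution_name f p q'" if "solution_name k p'' q" for q
      using H'[OF that] H H''(2)[OF p'(1)] by blast
    with p' p'' show "\<exists>p''. (K' \<circ>\<^sub>m K) p = Some p'' \<and> instance_name k p'' \<and>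
      (\<forall>q. solution_name k p'' q \<longrightarrow> (\<exists>q'. H'' (h p q) = Some q' \<and> solution_name f p q'))"
      by (intro exI[of _ p'']) (simp add: map_comp_def)
  qed
  with H''(1) comp[OF HK'(2) HK(2)] show ?thesis by (rule redI)
qed

text \<open>For reductions whose backward part uses the answer alone; a total computable pair of
  maps then works for all four reducibilities at once.\<close>

lemma le_of_computable:
  assumes "computable_fun (\<lambda>p. Some (k p))" "computable_fun (\<lambda>p. Some (m p))"
    and inst: "\<And>p. instance_name f p \<Longrightarrow> instance_name g (k p)"
    and soln: "\<And>p q. instance_name f p \<Longrightarrow> solution_name g (k p) q \<Longrightarrow> solution_name f p (m q)"
  shows "f \<preceq> g"
proof -
  obtain V where V: "\<C> V" "\<And>p q. V (h p q) = Some q" using answer_of_h by blast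
  show ?thesis
  proof (rule redI)
    show "\<C> ((\<lambda>p. Some (m p)) \<circ>\<^sub>m V)" "\<C> (\<lambda>p. Some (k p))"
      using assms(1,2) V(1) by (auto intro: comp computable)
    show "names_red h f g ((\<lambda>p. Some (m p)) \<circ>\<^sub>m V) (\<lambda>p. Some (k p))"
      unfolding names_red_def using inst soln V(2) by (simp add: map_comp_def)
  qed
qed

section \<open>Monotonicity and idempotence of the two operators\<close>

lemma parallelization_mono:
  assumes "f \<preceq> g" "solvable g"
  shows "\<Pi> f \<preceq> \<Pi> g"
proof -
  obtain H K where HK: "\<C> H" "\<C> K" "names_red h f g H K"
    using redE[OF assms] by blast
  obtain Z where Z: "\<C> (\<lambda>r. Some (Z r))"
    "\<And>p q n. component (Z (h p q)) n = h (component p n) (component q n)"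
    using components_of_h by blast
  let ?H = "map_components H \<circ>\<^sub>m (\<lambda>r. Some (Z r))"
  show ?thesis
  proof (rule redI)
    show "\<C> ?H" "\<C> (map_components K)"
      using HK(1,2) Z(1) by (auto intro: comp components)
    show "names_red h (\<Pi> f) (\<Pi> g) ?H (map_components K)"
      unfolding names_red_def
    proof (intro allI impI)
      fix p assume "instance_name (\<Pi> f) p"
      then have "\<forall>n. \<exists>p'. K (component p n) = Some p' \<and> instance_name g p' \<and>
          (\<forall>q. solution_name g p' q \<longrightarrow>
            (\<exists>q'. H (h (component p n) q) = Some q' \<and> solution_name f (component p n) q'))"
        using HK(3) unfolding names_red_def by simp
      then obtain p' where p': "\<And>n. K (component p n) = Some (p' n)" "\<And>n. instance_name g (p' n)"
        "\<And>n q. solution_name g (p' n) q \<Longrightarrow>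
            \<exists>q'. H (h (component p n) q) = Some q' \<and> solution_name f (component p n) q'"
        by metis
      have "\<exists>q'. ?H (h p q) = Some q' \<and> solution_name (\<Pi> f) p q'"
        if "solution_name (\<Pi> g) (baire_tuple p') q" for q
      proof -
        from that p'(3) have "\<forall>n. \<exists>q'. H (h (component p n) (component q n)) = Some q' \<and>
            solution_name f (component p n) q'" by simp
        then obtain q' where "\<forall>n. H (h (component p n) (component q n)) = Some (q' n) \<and>
            solution_name f (component p n) (q' n)" by (rule choice[THEN exE])
        then show ?thesis
          by (intro exI[of _ "baire_tuple q'"]) (simp add: map_comp_def map_components_eq_Some_iff Z(2))
      qed
      then show "\<exists>r. map_components K p = Some r \<and> instance_name (\<Pi> g) r \<and>
        (\<forall>q. solution_name (\<Pi> g) r q \<longrightarrow> (\<exists>q'. ?H (h p q) = Some q' \<and> solution_name (\<Pi> f) p q'))"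
        by (intro exI[of _ "baire_tuple p'"] conjI allI)
          (simp_all add: map_components_eq_Some_iff p'(1,2) del: solution_name_parallelization)
    qed
  qed
qed

text \<open>Since \<open>H\<close> acts on decoded answers, the function to be lifted is
  \<open>H \<circ>\<^sub>m W\<close>, decoding included. Positions stay fixed: wherever the given
  stash is correct the new one is, and elsewhere the lift still supplies some total name.\<close>

lemma stashing_mono:
  assumes "f \<preceq> g" "solvable f" "solvable g"
  shows "\<Sigma> f \<preceq> \<Sigma> g"
proof -
  obtain H K where HK: "\<C> H" "\<C> K" "names_red h f g H K"
    using redE[OF assms(1,3)] by blast
  obtain Z where Z: "\<C> (\<lambda>r. Some (Z r))"
    "\<And>p q n. component (Z (h p q)) n = h (component p n) (component q n)"
    using components_of_h by blast
  obtain W where W: "\<C> W" "\<And>p q r. minus_one q = Some r \<Longrightarrow> W (h p q) = Some (h p r)"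
    using minus_one_of_h by blast
  obtain L where L: "\<C> (\<lambda>p. Some (L p))" "\<And>p q. (H \<circ>\<^sub>m W) p = Some q \<Longrightarrow> minus_one (L p) = Some q"
    using lift[OF comp[OF HK(1) W(1)]] by blast
  let ?H = "map_components (\<lambda>p. Some (L p)) \<circ>\<^sub>m (\<lambda>r. Some (Z r))"
  show ?thesis
  proof (rule redI)
    show "\<C> ?H" "\<C> (map_components K)"
      using L(1) HK(2) Z(1) by (auto intro: comp components)
    show "names_red h (\<Sigma> f) (\<Sigma> g) ?H (map_components K)"
      unfolding names_red_def
    proof (intro allI impI)
      fix p assume "instance_name (\<Sigma> f) p"
      then have inst: "\<And>n. instance_name f (component p n)" using assms(2) by simp
      then have "\<forall>n. \<exists>p'. K (component p n) = Some p' \<and> instance_name g p' \<and>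
          (\<forall>q. solution_name g p' q \<longrightarrow>
            (\<exists>q'. H (h (component p n) q) = Some q' \<and> solution_name f (component p n) q'))"
        using HK(3) unfolding names_red_def by simp
      then obtain p' where p': "\<And>n. K (component p n) = Some (p' n)" "\<And>n. instance_name g (p' n)"
        "\<And>n q. solution_name g (p' n) q \<Longrightarrow>
            \<exists>q'. H (h (component p n) q) = Some q' \<and> solution_name f (component p n) q'"
        by metis
      have "\<exists>q'. ?H (h p q) = Some q' \<and> solution_name (\<Sigma> f) p q'"
        if "solution_name (\<Sigma> g) (baire_tuple p') q" for q
      proof -
        from that obtain n r where r: "minus_one (component q n) = Some r" "solution_name g (p' n) r"
          by auto
        from p'(3)[OF r(2)] obtain s where
          s: "H (h (component p n) r) = Some s" "solution_name f (component p n) s" by blast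
        have "minus_one (L (h (component p n) (component q n))) = Some s"
          by (rule L(2)) (simp add: map_comp_def W(2)[OF r(1)] s(1))
        with inst s(2) show ?thesis
          by (intro exI[of _ "baire_tuple (\<lambda>n. L (h (component p n) (component q n)))"])
            (auto simp: map_comp_def map_components_eq_Some_iff Z(2))
      qed
      then show "\<exists>r. map_components K p = Some r \<and> instance_name (\<Sigma> g) r \<and>
        (\<forall>q. solution_name (\<Sigma> g) r q \<longrightarrow> (\<exists>q'. ?H (h p q) = Some q' \<and> solution_name (\<Sigma> f) p q'))"
        using assms(3) by (intro exI[of _ "baire_tuple p'"] conjI allI)
          (simp_all add: map_components_eq_Some_iff p'(1,2) del: solution_name_stashing)
    qed
  qed
qed

lemma le_parallelization: "f \<preceq> \<Pi> f"
proof (rule le_of_computable)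
  show "computable_fun (\<lambda>p. Some (\<lambda>m. p (offset m)))"
    by (rule computable_totalI) (intro comp_on_intros; simp)
  show "computable_fun (\<lambda>p. Some (component p 0))" by (rule computable_component)
  have [simp]: "component (\<lambda>m. p (offset m)) n = p" for p n
    by (simp add: component_def)
  show "instance_name (\<Pi> f) (\<lambda>m. p (offset m))" if "instance_name f p" for p
    using that by simp
  show "solution_name f p (component q 0)" if "solution_name (\<Pi> f) (\<lambda>m. p (offset m)) q" for p q
    using that by simp
qed

lemma stashing_le:
  assumes "solvable f" shows "\<Sigma> f \<preceq> f"
proof (rule le_of_computable)
  show "computable_fun (\<lambda>p. Some (component p 0))" by (rule computable_component)
  show "computable_fun (\<lambda>p. Some (\<lambda>m. Suc (p (offset m))))"
    by (rule computable_totalI) (intro comp_on_intros; simp)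
  fix p assume p: "instance_name (\<Sigma> f) p"
  then show "instance_name f (component p 0)" using assms by simp
  fix q assume "solution_name f (component p 0) q"
  moreover have "minus_one (component (\<lambda>m. Suc (q (offset m))) 0) = Some q"
    by (simp add: component_def minus_one_Suc)
  ultimately show "solution_name (\<Sigma> f) p (\<lambda>m. Suc (q (offset m)))"
    using p assms by auto
qed

lemma parallelization_idem: "\<Pi> (\<Pi> f) \<preceq> \<Pi> f"
proof (rule le_of_computable[OF computable_flatten computable_unflatten])
  fix p q
  show "instance_name (\<Pi> f) (flatten p)" if "instance_name (\<Pi> (\<Pi> f)) p"
    using that by simp
  assume "solution_name (\<Pi> f) (flatten p) q"
  then have "solution_name f (component (component p i) j) (component q (cantor_pair i j))" for i j
    unfolding solution_name_parallelization component_flatten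
    by (metis block_cantor_pair offset_cantor_pair)
  then show "solution_name (\<Pi> (\<Pi> f)) p (unflatten q)" by simp
qed

text \<open>Cut the stash into subsequences. A correct outer position \<open>n\<close> and a correct
  inner position \<open>j\<close> make position \<open>cantor_pair n j\<close> correct; its answer
  is reached by decoding, selecting component \<open>j\<close> and decoding again.\<close>

lemma stashing_idem:
  assumes "solvable f" shows "\<Sigma> f \<preceq> \<Sigma> (\<Sigma> f)"
proof -
  have "\<exists>M. computable_fun (\<lambda>q. Some (M q)) \<and> (\<forall>q m r s.
      minus_one (component q (block m)) = Some r \<longrightarrow>
      minus_one (\<lambda>x. r (cantor_pair (offset m) x)) = Some s \<longrightarrow>
      minus_one (component (M q) m) = Some s)"
    by (rule computable_lift_components[where \<phi> = "\<lambda>m x. cantor_pair (offset m) x",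
      OF computable_fun_minus_one]) (intro comp_on_intros; simp)+
  then obtain M where M: "computable_fun (\<lambda>q. Some (M q))" "\<And>q m r s.
      minus_one (component q (block m)) = Some r \<Longrightarrow>
      minus_one (\<lambda>x. r (cantor_pair (offset m) x)) = Some s \<Longrightarrow>
      minus_one (component (M q) m) = Some s"
    by blast
  show ?thesis
  proof (rule le_of_computable[OF computable_unflatten M(1)])
    fix p assume p: "instance_name (\<Sigma> f) p"
    then show "instance_name (\<Sigma> (\<Sigma> f)) (unflatten p)" using assms by simp
    fix q assume "solution_name (\<Sigma> (\<Sigma> f)) (unflatten p) q"
    then obtain n r j s where "minus_one (component q n) = Some r" "minus_one (component r j) = Some s"
      "solution_name f (component p (cantor_pair n j)) s" by auto
    moreover from this have "minus_one (component (M q) (cantor_pair n j)) = Some s"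
      by (intro M(2)) (simp_all add: component_def)
    ultimately show "solution_name (\<Sigma> f) p (M q)" using p assms by auto
  qed
qed

text \<open>Position \<open>j\<close> of the stash holds all the instances that stand at position \<open>j\<close> of some sequence.\<close>

lemma parallelization_stashing_parallelization_le:
  assumes "solvable f" shows "\<Pi> (\<Sigma> (\<Pi> f)) \<preceq> \<Sigma> (\<Pi> f)"
proof -
  let ?k = "\<lambda>q m. q (cantor_pair (block (block (offset m)))
    (cantor_pair (block m) (cantor_pair (offset (block (offset m))) (offset (offset m)))))"
  \<comment> \<open>Output component \<langle>i, j\<rangle> at \<langle>l, k\<rangle> is entry
    \<open>k\<close> of the parallel answer with index \<langle>i, l\<rangle>: it keeps those
    answers that belong to sequence \<open>i\<close>.\<close>
  let ?\<phi> = "\<lambda>m x. cantor_pair (cantor_pair (block m) (block x)) (offset x)"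
  have "\<exists>M. computable_fun (\<lambda>q. Some (M q)) \<and> (\<forall>q m r s.
      minus_one (component q (offset m)) = Some r \<longrightarrow> Some (\<lambda>x. r (?\<phi> m x)) = Some s \<longrightarrow>
      minus_one (component (M q) m) = Some s)"
    by (rule computable_lift_components[where \<phi> = ?\<phi>, OF computable_fun_Some])
      (intro comp_on_intros; simp)+
  then obtain M where M: "computable_fun (\<lambda>q. Some (M q))" "\<And>q m r.
      minus_one (component q (offset m)) = Some r \<Longrightarrow>
      minus_one (component (M q) m) = Some (\<lambda>x. r (?\<phi> m x))"
    by auto
  have comp_k: "component (component (?k p) j) a =
      component (component (component p (block a)) j) (offset a)" for p j a
    by (simp add: component_def)
  have k: "computable_fun (\<lambda>q. Some (?k q))"
    by (rule computable_totalI) (intro comp_on_intros; simp)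
  have "computable_fun ((\<lambda>q. Some (unflatten q)) \<circ>\<^sub>m (\<lambda>q. Some (M q)))"
    by (intro computable_fun_comp computable_unflatten M(1))
  then have m: "computable_fun (\<lambda>q. Some (unflatten (M q)))" by (simp add: map_comp_def)
  show ?thesis
  proof (rule le_of_computable[OF k m])
    fix p assume "instance_name (\<Pi> (\<Sigma> (\<Pi> f))) p"
    then have p: "instance_name f (component (component (component p i) j) l)" for i j l
      using assms by simp
    then show "instance_name (\<Sigma> (\<Pi> f)) (?k p)" using assms by (simp add: comp_k)
    fix q assume "solution_name (\<Sigma> (\<Pi> f)) (?k p) q"
    then obtain j r where r: "minus_one (component q j) = Some r"
      "\<And>a. solution_name f (component (component (?k p) j) a) (component r a)" by auto
    \<comment> \<open>The same \<open>j\<close> works for every \<open>i\<close>, because a correct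
      parallel answer at position \<open>j\<close> is correct for all merged instances.\<close>
    have "\<exists>j s. minus_one (component (component (unflatten (M q)) i) j) = Some s \<and>
        (\<forall>l. solution_name f (component (component (component p i) j) l) (component s l))" for i
    proof (intro exI[of _ j] exI[of _ "\<lambda>x. r (?\<phi> (cantor_pair i j) x)"] conjI allI)
      show "minus_one (component (component (unflatten (M q)) i) j) = Some (\<lambda>x. r (?\<phi> (cantor_pair i j) x))"
        using r(1) by (simp only: component_unflatten) (rule M(2), simp)
      show "solution_name f (component (component (component p i) j) l)
          (component (\<lambda>x. r (?\<phi> (cantor_pair i j) x)) l)" for l
        using r(2)[of "cantor_pair i l"] unfolding comp_k by (simp add: component_def)
    qed
    then show "solution_name (\<Pi> (\<Sigma> (\<Pi> f))) p (unflatten (M q))" using p assms by auto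
  qed
qed

text \<open>
  The \<open>i\<close>-th sequence is cut into the subsequences with indices \<open>\<langle>n, j\<rangle>\<close>, one for each \<open>n\<close>, and position \<open>n\<close>
  of the outer stash holds the \<open>n\<close>-th subsequences for all \<open>i\<close>: then each of the instances given is used
  only once.
\<close>

lemma parallelization_stashing_le:
  assumes "solvable f" shows "\<Pi> (\<Sigma> f) \<preceq> \<Sigma> (\<Pi> (\<Sigma> f))"
proof -
  let ?k = "\<lambda>q m. q (cantor_pair (block (offset m))
    (cantor_pair (cantor_pair (block m) (block (offset (offset m)))) (offset (offset (offset m)))))"
  \<comment> \<open>Here \<open>m\<close> stands for \<langle>i, \<langle>n, j\<rangle>\<rangle>.
    The outer answer \<open>n\<close> is decoded first, then component \<open>i\<close> and within
    it component \<open>j\<close> are selected and decoded once more.\<close>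
  let ?\<phi> = "\<lambda>m x. cantor_pair (block m) (cantor_pair (offset (offset m)) x)"
  have "\<exists>M. computable_fun (\<lambda>q. Some (M q)) \<and> (\<forall>q m r s.
      minus_one (component q (block (offset m))) = Some r \<longrightarrow>
      minus_one (\<lambda>x. r (?\<phi> m x)) = Some s \<longrightarrow>
      minus_one (component (M q) m) = Some s)"
    by (rule computable_lift_components[where \<sigma> = "\<lambda>m. block (offset m)" and \<phi> = ?\<phi>,
      OF computable_fun_minus_one]) (intro comp_on_intros; simp)+
  then obtain M where M: "computable_fun (\<lambda>q. Some (M q))" "\<And>q m r s.
      minus_one (component q (block (offset m))) = Some r \<Longrightarrow>
      minus_one (\<lambda>x. r (?\<phi> m x)) = Some s \<Longrightarrow>
      minus_one (component (M q) m) = Some s"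
    by blast
  have comp_k: "component (component (component (?k p) n) i) j =
      component (component p i) (cantor_pair n j)" for p n i j
    by (simp add: component_def)
  have k: "computable_fun (\<lambda>q. Some (?k q))"
    by (rule computable_totalI) (intro comp_on_intros; simp)
  have "computable_fun ((\<lambda>q. Some (unflatten q)) \<circ>\<^sub>m (\<lambda>q. Some (M q)))"
    by (intro computable_fun_comp computable_unflatten M(1))
  then have m: "computable_fun (\<lambda>q. Some (unflatten (M q)))" by (simp add: map_comp_def)
  show ?thesis
  proof (rule le_of_computable[OF k m])
    fix p assume "instance_name (\<Pi> (\<Sigma> f)) p"
    then have p: "instance_name f (component (component p i) j)" for i j
      using assms by simp
    then show "instance_name (\<Sigma> (\<Pi> (\<Sigma> f))) (?k p)" using assms by (simp add: comp_k)
    fix q assume "solution_name (\<Sigma> (\<Pi> (\<Sigma> f))) (?k p) q"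
    then obtain n r where r: "minus_one (component q n) = Some r"
      "\<And>i. \<exists>j s. minus_one (component (component r i) j) = Some s \<and>
        solution_name f (component (component (component (?k p) n) i) j) s" by auto
    \<comment> \<open>The outer position \<open>n\<close> is common to all \<open>i\<close>, while
      \<open>j\<close> may vary with \<open>i\<close>; the correct position for \<open>i\<close> is
      \<langle>n, j\<rangle>.\<close>
    have "\<exists>j s. minus_one (component (component (unflatten (M q)) i) j) = Some s \<and>
        solution_name f (component (component p i) j) s" for i
    proof -
      from r(2)[of i] obtain j s where s: "minus_one (component (component r i) j) = Some s"
        "solution_name f (component (component p i) (cantor_pair n j)) s"
        unfolding comp_k by blast
      have "minus_one (component (M q) (cantor_pair i (cantor_pair n j))) = Some s"
        using r(1) s(1) by (intro M(2)) (simp_all add: component_def)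
      with s(2) show ?thesis by (intro exI[of _ "cantor_pair n j"] exI[of _ s]) simp
    qed
    then show "solution_name (\<Pi> (\<Sigma> f)) p (unflatten (M q))" using p by simp
  qed
qed

text \<open>From left to right the hypothesis is fed into a monotone operator and the surplus
  operator is absorbed. The chains are \<Pi> f \<le> \<Pi>\<Sigma>\<Pi> f \<le> \<Sigma>\<Pi> f,
  then \<Sigma>\<Pi> f \<le> \<Sigma>\<Sigma>\<Pi> f \<le> \<Sigma> f, then \<Pi> f \<le>
  \<Pi>\<Pi>\<Sigma> f \<le> \<Pi>\<Sigma> f, and \<Pi>\<Sigma> f \<le> \<Sigma>\<Pi>\<Sigma> f
  \<le> \<Sigma> f. The other half of each equivalence holds for every solvable f, and the converse
  is transitivity with f \<le> \<Pi> f or \<Sigma> f \<le> f.\<close>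

lemma pentagon_equivalences:
  assumes f: "solvable f"
  shows "f \<preceq> \<Sigma> (\<Pi> f) \<longleftrightarrow> \<Pi> f \<preceq> \<Sigma> (\<Pi> f) \<and> \<Sigma> (\<Pi> f) \<preceq> \<Pi> f"
    and "\<Sigma> (\<Pi> f) \<preceq> f \<longleftrightarrow> \<Sigma> f \<preceq> \<Sigma> (\<Pi> f) \<and> \<Sigma> (\<Pi> f) \<preceq> \<Sigma> f"
    and "f \<preceq> \<Pi> (\<Sigma> f) \<longleftrightarrow> \<Pi> f \<preceq> \<Pi> (\<Sigma> f) \<and> \<Pi> (\<Sigma> f) \<preceq> \<Pi> f"
    and "\<Pi> (\<Sigma> f) \<preceq> f \<longleftrightarrow> \<Sigma> f \<preceq> \<Pi> (\<Sigma> f) \<and> \<Pi> (\<Sigma> f) \<preceq> \<Sigma> f"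
proof -
  note sol = f solvable_parallelization solvable_stashing
  show "f \<preceq> \<Sigma> (\<Pi> f) \<longleftrightarrow> \<Pi> f \<preceq> \<Sigma> (\<Pi> f) \<and> \<Sigma> (\<Pi> f) \<preceq> \<Pi> f"
    using le_trans[OF le_parallelization] le_trans[OF parallelization_mono parallelization_stashing_parallelization_le]
      stashing_le sol by metis
  show "\<Sigma> (\<Pi> f) \<preceq> f \<longleftrightarrow> \<Sigma> f \<preceq> \<Sigma> (\<Pi> f) \<and> \<Sigma> (\<Pi> f) \<preceq> \<Sigma> f"
    using le_trans[OF _ stashing_le] le_trans[OF stashing_idem stashing_mono]
      stashing_mono[OF le_parallelization] sol by metis
  show "f \<preceq> \<Pi> (\<Sigma> f) \<longleftrightarrow> \<Pi> f \<preceq> \<Pi> (\<Sigma> f) \<and> \<Pi> (\<Sigma> f) \<preceq> \<Pi> f"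
    using le_trans[OF le_parallelization] le_trans[OF parallelization_mono parallelization_idem]
      parallelization_mono[OF stashing_le] sol by metis
  show "\<Pi> (\<Sigma> f) \<preceq> f \<longleftrightarrow> \<Sigma> f \<preceq> \<Pi> (\<Sigma> f) \<and> \<Pi> (\<Sigma> f) \<preceq> \<Sigma> f"
    using le_trans[OF _ stashing_le] le_trans[OF parallelization_stashing_le stashing_mono]
      le_parallelization sol by metis
qed

end

section \<open>The four reducibilities as instances\<close>

lemma reducibility_computable:
  assumes "h = (\<lambda>p q. q) \<or> h = baire_pair" shows "reducibility computable_fun h"
  using assms computable_fun_comp computable_fun_pair computable_fun_map_components computable_fun_lift
  by unfold_locales

lemma reducibility_continuous:
  assumes "h = (\<lambda>p q. q) \<or> h = baire_pair" shows "reducibility continuous_fun h"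
  using assms continuous_fun_of_computable continuous_fun_comp continuous_fun_pair
    continuous_fun_map_components continuous_fun_lift
  by unfold_locales

theorem corollary3p3:
  fixes f :: "('a, 'b) problem"
  assumes "is_problem f"
  shows
    "(f \<le>\<^sub>s\<^sub>W \<Sigma> (\<Pi> f) \<longleftrightarrow> \<Pi> f \<equiv>\<^sub>s\<^sub>W \<Sigma> (\<Pi> f)) \<and>
     (\<Sigma> (\<Pi> f) \<le>\<^sub>s\<^sub>W f \<longleftrightarrow> \<Sigma> f \<equiv>\<^sub>s\<^sub>W \<Sigma> (\<Pi> f)) \<and>
     (f \<le>\<^sub>s\<^sub>W \<Pi> (\<Sigma> f) \<longleftrightarrow> \<Pi> f \<equiv>\<^sub>s\<^sub>W \<Pi> (\<Sigma> f)) \<and>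
     (\<Pi> (\<Sigma> f) \<le>\<^sub>s\<^sub>W f \<longleftrightarrow> \<Sigma> f \<equiv>\<^sub>s\<^sub>W \<Pi> (\<Sigma> f)) \<and>
     (f \<le>\<^sub>W \<Sigma> (\<Pi> f) \<longleftrightarrow> \<Pi> f \<equiv>\<^sub>W \<Sigma> (\<Pi> f)) \<and>
     (\<Sigma> (\<Pi> f) \<le>\<^sub>W f \<longleftrightarrow> \<Sigma> f \<equiv>\<^sub>W \<Sigma> (\<Pi> f)) \<and>
     (f \<le>\<^sub>W \<Pi> (\<Sigma> f) \<longleftrightarrow> \<Pi> f \<equiv>\<^sub>W \<Pi> (\<Sigma> f)) \<and>
     (\<Pi> (\<Sigma> f) \<le>\<^sub>W f \<longleftrightarrow> \<Sigma> f \<equiv>\<^sub>W \<Pi> (\<Sigma> f)) \<and>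
     (f \<le>\<^sub>s\<^sub>W\<^sup>* \<Sigma> (\<Pi> f) \<longleftrightarrow> \<Pi> f \<equiv>\<^sub>s\<^sub>W\<^sup>* \<Sigma> (\<Pi> f)) \<and>
     (\<Sigma> (\<Pi> f) \<le>\<^sub>s\<^sub>W\<^sup>* f \<longleftrightarrow> \<Sigma> f \<equiv>\<^sub>s\<^sub>W\<^sup>* \<Sigma> (\<Pi> f)) \<and>
     (f \<le>\<^sub>s\<^sub>W\<^sup>* \<Pi> (\<Sigma> f) \<longleftrightarrow> \<Pi> f \<equiv>\<^sub>s\<^sub>W\<^sup>* \<Pi> (\<Sigma> f)) \<and>
     (\<Pi> (\<Sigma> f) \<le>\<^sub>s\<^sub>W\<^sup>* f \<longleftrightarrow> \<Sigma> f \<equiv>\<^sub>s\<^sub>W\<^sup>* \<Pi> (\<Sigma> f)) \<and>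
     (f \<le>\<^sub>W\<^sup>* \<Sigma> (\<Pi> f) \<longleftrightarrow> \<Pi> f \<equiv>\<^sub>W\<^sup>* \<Sigma> (\<Pi> f)) \<and>
     (\<Sigma> (\<Pi> f) \<le>\<^sub>W\<^sup>* f \<longleftrightarrow> \<Sigma> f \<equiv>\<^sub>W\<^sup>* \<Sigma> (\<Pi> f)) \<and>
     (f \<le>\<^sub>W\<^sup>* \<Pi> (\<Sigma> f) \<longleftrightarrow> \<Pi> f \<equiv>\<^sub>W\<^sup>* \<Pi> (\<Sigma> f)) \<and>
     (\<Pi> (\<Sigma> f) \<le>\<^sub>W\<^sup>* f \<longleftrightarrow> \<Sigma> f \<equiv>\<^sub>W\<^sup>* \<Pi> (\<Sigma> f))"
proof -
  have f: "solvable f"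
    using assms unfolding is_problem_def solvable_iff_realizer by blast
  interpret sW: reducibility computable_fun "\<lambda>p q. q" by (rule reducibility_computable) simp
  interpret W: reducibility computable_fun baire_pair by (rule reducibility_computable) simp
  interpret sW_star: reducibility continuous_fun "\<lambda>p q. q" by (rule reducibility_continuous) simp
  interpret W_star: reducibility continuous_fun baire_pair by (rule reducibility_continuous) simp
  show ?thesis
    unfolding strong_reducible_eq_red reducible_eq_red
    by (intro conjI sW.pentagon_equivalences W.pentagon_equivalences
      sW_star.pentagon_equivalences W_star.pentagon_equivalences f)
qed

end
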